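(* Let $U\subseteq V\subseteq R^d$ be $R$-submodules, fix a monomial order $\prec$ on $R^d$, and let $H=H^{(0)}=\{\mathbf h_1,\dots,\mathbf h_t\}$ be the reduced Gröbner basis of $V$ relative to $U$. Then $H$ deterministically induces Gröbner bases $H^{(i)}$, $i\ge1$, of the syzygy modules $\mathrm{Syz}^i(H)\subseteq R^{t_i}$, where $t_i=|H^{(i-1)}|$. Explicitly, the finite set $H^{(1)}\subseteq R^t$ of projected Schreyer syzygies is a Gröbner basis of $\mathrm{Syz}^1(H)=\{(f_1,\dots,f_t)\in R^t\mid \sum_{i=1}^t f_i\mathbf h_i\in U\}$ with respect to the monomial order $\prec_H$ on $R^t$, and, for each $i\ge1$, the set $H^{(i+1)}$ obtained from $H^{(i)}$ by Schreyer's construction is a Gröbner basis of $\mathrm{Syz}^{i+1}(H)$, the module of syzygies of the elements of $H^{(i)}$.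
   Context: $\Bbbk$ is a field, $R=\Bbbk[X_1,\dots,X_n]$, $R^d$ is free with standard basis $\mathbf e_1,\dots,\mathbf e_d$, and module monomials are the elements $X^\alpha\mathbf e_i$; $\mathrm{Mon}(R^d)$ is the set of them. A monomial order is a well-order on $\mathrm{Mon}(R^d)$ compatible with multiplication by monomials. $\mathrm{lm},\mathrm{lc},\mathrm{lt}$ denote leading monomial, coefficient and term, and $\mathrm{lm}(U)$ is the $\Bbbk$-span of the leading monomials of non-zero elements of a submodule $U$. A Gröbner basis of a submodule $W$ is a finite generating set $G$ of $W$ with $\langle\mathrm{lm}(G)\rangle=\mathrm{lm}(W)$. A Gröbner basis of $V$ relative to $U$ is a finite set $H\subseteq V\setminus U$ whose elements are supported on $\mathrm{Mon}(R^d)\setminus\mathrm{lm}(U)$ with $\langle\mathrm{lm}(H)\rangle+\mathrm{lm}(U)=\mathrm{lm}(V)$. It is reduced if there are no divisibility relations among leading monomials of distinct elements and, for all $\mathbf h\in H$, $\mathrm{lc}(\mathbf h)=1$ and $\mathbf h-\mathrm{lm}(\mathbf h)$ is supported on $\mathrm{Mon}(R^d)\setminus\mathrm{lm}(V)$. The reduced relative Gröbner basis exists and is unique. Schreyer's construction: for a Gröbner basis $G=\{\mathbf g_1,\dots,\mathbf g_s\}$ (listed in some order) of a submodule of a free module, and $i<j$ such that $\mathrm{lm}(\mathbf g_i)$ and $\mathrm{lm}(\mathbf g_j)$ involve the same basis vector, put $\mathbf m_{ij}=\mathrm{lcm}(\mathrm{lm}(\mathbf g_i),\mathrm{lm}(\mathbf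 g_j))$, $\mathbf S(\mathbf g_i,\mathbf g_j)=\frac{\mathbf m_{ij}}{\mathrm{lt}(\mathbf g_i)}\mathbf g_i-\frac{\mathbf m_{ij}}{\mathrm{lt}(\mathbf g_j)}\mathbf g_j$; by the division algorithm write $\mathbf S(\mathbf g_i,\mathbf g_j)=\sum_k a_{ijk}\mathbf g_k$ with $\mathrm{lm}(a_{ijk}\mathbf g_k)\preceq\mathrm{lm}(\mathbf S(\mathbf g_i,\mathbf g_j))$ whenever $a_{ijk}\ne0$ (all $a_{ijk}=0$ if the S-polynomial is $0$), and set $$\mathbf S_{ij}=\tfrac{\mathbf m_{ij}}{\mathrm{lt}(\mathbf g_i)}\mathbf e_i-\tfrac{\mathbf m_{ij}}{\mathrm{lt}(\mathbf g_j)}\mathbf e_j-\sum_k a_{ijk}\mathbf e_k\in R^s .$$ The output is the set of all these $\mathbf S_{ij}$. The induced order $\prec_G$ on $R^s$ is: $X^\alpha\mathbf e_i\prec_G X^\beta\mathbf e_j$ iff $\mathrm{lm}(X^\alpha\mathbf g_i)\prec\mathrm{lm}(X^\beta\mathbf g_j)$, or these are equal and $i>j$. The choices made in the division algorithm are assumed to follow some fixed rule. Projected syzygies: let $\{\mathbf g_{t+1},\dots,\mathbf g_s\}$ be a Gröbner basis of $U$ and $\mathbf g_i=\mathbf h_i$ for $i\le t$, so $G=\{\mathbf g_1,\dots,\mathbf g_s\}$ is a Gröbner basis of $V$. Apply Schreyer's construction to $G$, where standard representations are obtained by the relative division algorithm: at each step the leading term of the current element is cancelled by an element of $\{\mathbf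 g_{t+1},\dots,\mathbf g_s\}$ if possible, and otherwise by an element of $\{\mathbf h_1,\dots,\mathbf h_t\}$. Let $\pi\colon R^s\to R^t$ be the projection onto the first $t$ coordinates. Then $H^{(1)}=\{\pi(\mathbf S_{ij})\mid i<j\le s,\ i\le t\}$ ($\mathbf S_{ij}$ being defined only for pairs $i<j$ such that $\mathrm{lm}(\mathbf g_i)$ and $\mathrm{lm}(\mathbf g_j)$ involve the same basis vector). The order $\prec_H$ on $R^t$ is defined from $\mathbf h_1,\dots,\mathbf h_t$ by the same rule as $\prec_G$. For $i\ge1$: $H^{(i)}=\{\mathbf u_1,\dots,\mathbf u_{t_{i+1}}\}\subseteq R^{t_i}$ is listed in some order, $t_{i+1}=|H^{(i)}|$, $\mathrm{Syz}^{i+1}(H)\subseteq R^{t_{i+1}}$ is the module of $R$-linear relations among the elements of $H^{(i)}$, and $R^{t_{i+1}}$ carries the order induced by $H^{(i)}$, namely: $X^\alpha\mathbf e_k$ is smaller than $X^\beta\mathbf e_l$ iff $\mathrm{lm}(X^\alpha\mathbf u_k)$ is smaller than $\mathrm{lm}(X^\beta\mathbf u_l)$ in the order already defined on $R^{t_i}$ (which for $i=1$ is $\prec_H$ on $R^{t_1}=R^t$), or these leading monomials are equal and $k>l$. *)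

theory Defs
  imports Complex_Main "HOL-Library.Poly_Mapping"
begin

section \<open>Polynomials and free modules\<close>

text \<open>
  The polynomial ring in the variables \<open>'x\<close> (a finite type) over \<open>'k\<close>. All free modules \<open>R^m\<close>
  live in one type; \<open>R^m\<close> is the set of vectors supported on the indices \<open>0, \<dots>, m - 1\<close>
  (indices are counted from \<open>0\<close> throughout).
\<close>

type_synonym ('x, 'k) mpoly = "('x \<Rightarrow>\<^sub>0 nat) \<Rightarrow>\<^sub>0 'k"
type_synonym ('x, 'k) vec = "nat \<Rightarrow>\<^sub>0 ('x, 'k) mpoly"

text \<open>The pair \<open>(a, i)\<close> encodes the module monomial \<open>X^a e_i\<close>.\<close>

type_synonym 'x mmon = "('x \<Rightarrow>\<^sub>0 nat) \<times> nat"

definition free_mod :: "nat \<Rightarrow> ('x, 'k::field) vec set" where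
  "free_mod m = {f. Poly_Mapping.keys f \<subseteq> {..<m}}"

definition smul :: "('x, 'k::field) mpoly \<Rightarrow> ('x, 'k) vec \<Rightarrow> ('x, 'k) vec" where
  "smul p f = Poly_Mapping.map ((*) p) f"

definition kscale :: "'k::field \<Rightarrow> ('x, 'k) vec \<Rightarrow> ('x, 'k) vec" where
  "kscale c f = smul (Poly_Mapping.single 0 c) f"

lemma lookup_smul [simp]: "Poly_Mapping.lookup (smul p f) i = p * Poly_Mapping.lookup f i"
  by (simp add: smul_def Poly_Mapping.map.rep_eq when_def)

interpretation Rmod: module "smul :: ('x, 'k::field) mpoly \<Rightarrow> ('x, 'k) vec \<Rightarrow> ('x, 'k) vec"
  by standard (auto intro!: poly_mapping_eqI simp: lookup_add algebra_simps)

interpretation kvec: vector_space "kscale :: 'k::field \<Rightarrow> ('x, 'k) vec \<Rightarrow> ('x, 'k) vec"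
proof
  fix a b :: 'k and f g :: "('x, 'k) vec"
  show "kscale a (f + g) = kscale a f + kscale a g"
    by (simp add: kscale_def Rmod.scale_right_distrib)
  show "kscale (a + b) f = kscale a f + kscale b f"
    by (simp add: kscale_def single_add Rmod.scale_left_distrib)
  show "kscale a (kscale b f) = kscale (a * b) f"
    by (simp add: kscale_def mult_single)
  show "kscale 1 f = f"
    by (simp add: kscale_def)
qed


section \<open>Module monomials and monomial orders\<close>

definition Mon :: "nat \<Rightarrow> 'x mmon set" where
  "Mon m = {u. snd u < m}"

definition mon_mult :: "('x \<Rightarrow>\<^sub>0 nat) \<Rightarrow> 'x mmon \<Rightarrow> 'x mmon" where
  "mon_mult c u = (c + fst u, snd u)"

definition mon_dvd :: "'x mmon \<Rightarrow> 'x mmon \<Rightarrow> bool" where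
  "mon_dvd u v \<longleftrightarrow> (\<exists>c. v = mon_mult c u)"

definition mon_vec :: "'x mmon \<Rightarrow> ('x, 'k::field) vec" where
  "mon_vec u = Poly_Mapping.single (snd u) (Poly_Mapping.single (fst u) 1)"

text \<open>An order is given by its reflexive version; the strict order is \<open>r - Id\<close>.\<close>

definition monomial_order :: "nat \<Rightarrow> 'x mmon rel \<Rightarrow> bool" where
  "monomial_order m r \<longleftrightarrow> well_order_on (Mon m) r \<and>
     (\<forall>c u v. (u, v) \<in> r \<longrightarrow> (mon_mult c u, mon_mult c v) \<in> r)"

definition mcoeff :: "('x, 'k::field) vec \<Rightarrow> 'x mmon \<Rightarrow> 'k" where
  "mcoeff f u = Poly_Mapping.lookup (Poly_Mapping.lookup f (snd u)) (fst u)"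

definition supp :: "('x, 'k::field) vec \<Rightarrow> 'x mmon set" where
  "supp f = {u. mcoeff f u \<noteq> 0}"

text \<open>Leading monomials are only meaningful for nonzero vectors.\<close>

definition lm :: "'x mmon rel \<Rightarrow> ('x, 'k::field) vec \<Rightarrow> 'x mmon" where
  "lm r f = (THE u. u \<in> supp f \<and> (\<forall>v \<in> supp f. (v, u) \<in> r))"

definition lc :: "'x mmon rel \<Rightarrow> ('x, 'k::field) vec \<Rightarrow> 'k" where
  "lc r f = mcoeff f (lm r f)"

definition lm_space :: "'x mmon rel \<Rightarrow> ('x, 'k::field) vec set \<Rightarrow> ('x, 'k) vec set" where
  "lm_space r W = kvec.span ((\<lambda>f. mon_vec (lm r f)) ` (W - {0}))"

definition lm_gen :: "'x mmon rel \<Rightarrow> ('x, 'k::field) vec set \<Rightarrow> ('x, 'k) vec set" where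
  "lm_gen r G = Rmod.span ((\<lambda>g. mon_vec (lm r g)) ` G)"


section \<open>Groebner bases\<close>

definition groebner_basis ::
  "'x mmon rel \<Rightarrow> ('x, 'k::field) vec set \<Rightarrow> ('x, 'k) vec set \<Rightarrow> bool" where
  "groebner_basis r W G \<longleftrightarrow>
     finite G \<and> 0 \<notin> G \<and> Rmod.span G = W \<and> lm_gen r G = lm_space r W"

definition rel_groebner_basis ::
  "nat \<Rightarrow> 'x mmon rel \<Rightarrow> ('x, 'k::field) vec set \<Rightarrow> ('x, 'k) vec set \<Rightarrow> ('x, 'k) vec set \<Rightarrow> bool" where
  "rel_groebner_basis d r U V H \<longleftrightarrow>
     finite H \<and> H \<subseteq> V - U \<and>
     (\<forall>h \<in> H. supp h \<subseteq> {u \<in> Mon d. mon_vec u \<notin> lm_space r U}) \<and>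
     {a + b | a b. a \<in> lm_gen r H \<and> b \<in> lm_space r U} = lm_space r V"

definition reduced_rel_groebner_basis ::
  "nat \<Rightarrow> 'x mmon rel \<Rightarrow> ('x, 'k::field) vec set \<Rightarrow> ('x, 'k) vec set \<Rightarrow> ('x, 'k) vec set \<Rightarrow> bool" where
  "reduced_rel_groebner_basis d r U V H \<longleftrightarrow>
     rel_groebner_basis d r U V H \<and>
     (\<forall>h \<in> H. \<forall>h' \<in> H. h \<noteq> h' \<longrightarrow> \<not> mon_dvd (lm r h) (lm r h')) \<and>
     (\<forall>h \<in> H. lc r h = 1 \<and>
        supp (h - mon_vec (lm r h)) \<subseteq> {u \<in> Mon d. mon_vec u \<notin> lm_space r V})"


section \<open>The division algorithm\<close>

definition cancels ::
  "'x mmon rel \<Rightarrow> ('x, 'k::field) vec list \<Rightarrow> ('x, 'k) vec \<Rightarrow> nat \<Rightarrow> bool" where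
  "cancels r gs f k \<longleftrightarrow> k < length gs \<and> mon_dvd (lm r (gs ! k)) (lm r f)"

text \<open>The divisors are \<open>hs @ us\<close>; the elements of \<open>us\<close> have priority.\<close>

definition rel_cancels ::
  "'x mmon rel \<Rightarrow> ('x, 'k::field) vec list \<Rightarrow> ('x, 'k) vec list \<Rightarrow> ('x, 'k) vec \<Rightarrow> nat \<Rightarrow> bool" where
  "rel_cancels r hs us f k \<longleftrightarrow> cancels r (hs @ us) f k \<and>
     (k < length hs \<longrightarrow> \<not> (\<exists>l \<ge> length hs. cancels r (hs @ us) f l))"

text \<open>The term \<open>lt f / lt g\<close>, for \<open>lm g\<close> dividing \<open>lm f\<close>.\<close>

definition lt_quot :: "'x mmon rel \<Rightarrow> ('x, 'k::field) vec \<Rightarrow> ('x, 'k) vec \<Rightarrow> ('x, 'k) mpoly" where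
  "lt_quot r f g = Poly_Mapping.single (fst (lm r f) - fst (lm r g)) (lc r f / lc r g)"

text \<open>
  \<open>division r gs ok f a\<close>: some run of the division algorithm by \<open>gs\<close>, in which the index \<open>k\<close>
  used on the current element \<open>f\<close> always satisfies \<open>ok f k\<close>, reduces \<open>f\<close> to \<open>0\<close> with
  quotients \<open>a\<close>, i.e. \<open>f = (\<Sum>k. a_k g_k)\<close>.
\<close>

inductive division ::
  "'x mmon rel \<Rightarrow> ('x, 'k::field) vec list \<Rightarrow> (('x, 'k) vec \<Rightarrow> nat \<Rightarrow> bool) \<Rightarrow>
   ('x, 'k) vec \<Rightarrow> ('x, 'k) vec \<Rightarrow> bool"
  for r gs ok where
  zero: "division r gs ok 0 0"
| step: "division r gs ok f (a + Poly_Mapping.single k (lt_quot r f (gs ! k)))"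
  if "f \<noteq> 0" and "ok f k" and "division r gs ok (f - smul (lt_quot r f (gs ! k)) (gs ! k)) a"

text \<open>
  A fixed rule for the choices made in the division algorithm: a function selecting the quotients
  of one run for every element that can be reduced to \<open>0\<close>. The second definition is the same for
  the relative division algorithm.
\<close>

definition division_rule ::
  "('x mmon rel \<Rightarrow> ('x, 'k::field) vec list \<Rightarrow> ('x, 'k) vec \<Rightarrow> ('x, 'k) vec) \<Rightarrow> bool" where
  "division_rule D \<longleftrightarrow> (\<forall>r gs f. (\<exists>a. division r gs (cancels r gs) f a) \<longrightarrow>
     division r gs (cancels r gs) f (D r gs f))"

definition rel_division_rule ::
  "('x mmon rel \<Rightarrow> ('x, 'k::field) vec list \<Rightarrow> ('x, 'k) vec list \<Rightarrow> ('x, 'k) vec \<Rightarrow> ('x, 'k) vec)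
   \<Rightarrow> bool" where
  "rel_division_rule D \<longleftrightarrow>
     (\<forall>r hs us f. (\<exists>a. division r (hs @ us) (rel_cancels r hs us) f a) \<longrightarrow>
        division r (hs @ us) (rel_cancels r hs us) f (D r hs us f))"


section \<open>Schreyer's construction\<close>

text \<open>Subtraction of exponents is truncated, so this is the pointwise maximum.\<close>

definition exp_lcm :: "('x \<Rightarrow>\<^sub>0 nat) \<Rightarrow> ('x \<Rightarrow>\<^sub>0 nat) \<Rightarrow> ('x \<Rightarrow>\<^sub>0 nat)" where
  "exp_lcm a b = a + (b - a)"

lemma lookup_exp_lcm:
  "Poly_Mapping.lookup (exp_lcm a b) x = max (Poly_Mapping.lookup a x) (Poly_Mapping.lookup b x)"
  by (simp add: exp_lcm_def lookup_add lookup_minus)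

text \<open>The term \<open>m / lt f\<close> with \<open>m = lcm (lm f) (lm g)\<close>.\<close>

definition cofactor :: "'x mmon rel \<Rightarrow> ('x, 'k::field) vec \<Rightarrow> ('x, 'k) vec \<Rightarrow> ('x, 'k) mpoly" where
  "cofactor r f g =
     Poly_Mapping.single (exp_lcm (fst (lm r f)) (fst (lm r g)) - fst (lm r f)) (1 / lc r f)"

definition spoly :: "'x mmon rel \<Rightarrow> ('x, 'k::field) vec \<Rightarrow> ('x, 'k) vec \<Rightarrow> ('x, 'k) vec" where
  "spoly r f g = smul (cofactor r f g) f - smul (cofactor r g f) g"

definition spair :: "'x mmon rel \<Rightarrow> ('x, 'k::field) vec list \<Rightarrow> nat \<Rightarrow> nat \<Rightarrow> bool" where
  "spair r gs i j \<longleftrightarrow> i < j \<and> j < length gs \<and> snd (lm r (gs ! i)) = snd (lm r (gs ! j))"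

text \<open>The syzygy \<open>S_ij\<close> formed with the quotients \<open>a\<close> of the S-polynomial.\<close>

definition schreyer_syz ::
  "'x mmon rel \<Rightarrow> ('x, 'k::field) vec list \<Rightarrow> nat \<Rightarrow> nat \<Rightarrow> ('x, 'k) vec \<Rightarrow> ('x, 'k) vec" where
  "schreyer_syz r gs i j a =
     Poly_Mapping.single i (cofactor r (gs ! i) (gs ! j))
     - Poly_Mapping.single j (cofactor r (gs ! j) (gs ! i)) - a"

definition schreyer_syzygies ::
  "('x mmon rel \<Rightarrow> ('x, 'k::field) vec list \<Rightarrow> ('x, 'k) vec \<Rightarrow> ('x, 'k) vec) \<Rightarrow>
   'x mmon rel \<Rightarrow> ('x, 'k) vec list \<Rightarrow> ('x, 'k) vec set" where
  "schreyer_syzygies D r gs =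
     {schreyer_syz r gs i j (D r gs (spoly r (gs ! i) (gs ! j))) | i j. spair r gs i j}"

definition proj :: "nat \<Rightarrow> ('x, 'k::field) vec \<Rightarrow> ('x, 'k) vec" where
  "proj t f = (\<Sum>i<t. Poly_Mapping.single i (Poly_Mapping.lookup f i))"

definition projected_syzygies ::
  "('x mmon rel \<Rightarrow> ('x, 'k::field) vec list \<Rightarrow> ('x, 'k) vec list \<Rightarrow> ('x, 'k) vec \<Rightarrow> ('x, 'k) vec) \<Rightarrow>
   'x mmon rel \<Rightarrow> ('x, 'k) vec list \<Rightarrow> ('x, 'k) vec list \<Rightarrow> ('x, 'k) vec set" where
  "projected_syzygies D r hs us =
     {proj (length hs)
        (schreyer_syz r (hs @ us) i j (D r hs us (spoly r ((hs @ us) ! i) ((hs @ us) ! j)))) | i j.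
      spair r (hs @ us) i j \<and> i < length hs}"

text \<open>
  The order induced by \<open>gs\<close>, again in reflexive form: ties between leading monomials are broken
  in favour of the smaller index.
\<close>

definition induced_less :: "'x mmon rel \<Rightarrow> ('x, 'k::field) vec list \<Rightarrow> 'x mmon \<Rightarrow> 'x mmon \<Rightarrow> bool" where
  "induced_less r gs u v \<longleftrightarrow>
     (let p = lm r (smul (Poly_Mapping.single (fst u) 1) (gs ! snd u));
          q = lm r (smul (Poly_Mapping.single (fst v) 1) (gs ! snd v))
      in (p, q) \<in> r - Id \<or> p = q \<and> snd u > snd v)"

definition induced_order :: "'x mmon rel \<Rightarrow> ('x, 'k::field) vec list \<Rightarrow> 'x mmon rel" where
  "induced_order r gs =
     {(u, v). u \<in> Mon (length gs) \<and> v \<in> Mon (length gs) \<and> (u = v \<or> induced_less r gs u v)}"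


section \<open>Syzygy modules and the iterated construction\<close>

definition lin_comb :: "('x, 'k::field) vec list \<Rightarrow> ('x, 'k) vec \<Rightarrow> ('x, 'k) vec" where
  "lin_comb gs f = (\<Sum>i<length gs. smul (Poly_Mapping.lookup f i) (gs ! i))"

definition rel_syz :: "('x, 'k::field) vec set \<Rightarrow> ('x, 'k) vec list \<Rightarrow> ('x, 'k) vec set" where
  "rel_syz U hs = {f \<in> free_mod (length hs). lin_comb hs f \<in> U}"

definition syz :: "('x, 'k::field) vec list \<Rightarrow> ('x, 'k) vec set" where
  "syz gs = {f \<in> free_mod (length gs). lin_comb gs f = 0}"

text \<open>A rule fixing, at each stage, the order in which the elements of a finite set are listed.\<close>

definition listing_rule :: "(nat \<Rightarrow> 'a set \<Rightarrow> 'a list) \<Rightarrow> bool" where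
  "listing_rule L \<longleftrightarrow> (\<forall>i A. finite A \<longrightarrow> set (L i A) = A \<and> distinct (L i A))"

text \<open>
  Stage \<open>i\<close> consists of the set \<open>H^(i)\<close> together with the order on the free module containing it;
  \<open>us\<close> lists the chosen Groebner basis of \<open>U\<close>.
\<close>

primrec stage ::
  "(nat \<Rightarrow> ('x, 'k::field) vec set \<Rightarrow> ('x, 'k) vec list) \<Rightarrow>
   ('x mmon rel \<Rightarrow> ('x, 'k) vec list \<Rightarrow> ('x, 'k) vec list \<Rightarrow> ('x, 'k) vec \<Rightarrow> ('x, 'k) vec) \<Rightarrow>
   ('x mmon rel \<Rightarrow> ('x, 'k) vec list \<Rightarrow> ('x, 'k) vec \<Rightarrow> ('x, 'k) vec) \<Rightarrow>
   'x mmon rel \<Rightarrow> ('x, 'k) vec list \<Rightarrow> ('x, 'k) vec set \<Rightarrow> nat \<Rightarrow>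
   'x mmon rel \<times> ('x, 'k) vec set" where
  "stage L D\<^sub>0 D r us H 0 = (r, H)"
| "stage L D\<^sub>0 D r us H (Suc i) =
     (let (q, A) = stage L D\<^sub>0 D r us H i; gs = L i A
      in (induced_order q gs,
          if i = 0 then projected_syzygies D\<^sub>0 q gs us else schreyer_syzygies D q gs))"

end

theory Submission
  imports Defs
begin

text \<open>
  Being a Groebner basis is a statement about leading monomials alone: by division, a finite set
  \<open>G\<close> of nonzero elements of a submodule \<open>W\<close> is one iff every leading
  monomial of \<open>W\<close> is divisible by that of an element of \<open>G\<close>
  (\<open>groebner_basis_iff\<close>). So it suffices to know the leading monomials of the projected
  Schreyer syzygies and to see that they cover those of all relations.

  Let \<open>g\<close> be the list \<open>hs @ us\<close>. For \<open>i < j\<close> with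
  \<open>g_i\<close> in \<open>hs\<close>, the leading monomial of the projection of
  \<open>S_ij\<close> is \<open>m_ij / lm g_i\<close> times \<open>e_i\<close>
  (\<open>projected_syzygy_lm\<close>): the \<open>e_j\<close>-term, if the projection keeps it,
  loses the tie, and all other terms come from a division of an element lying below
  \<open>m_ij\<close>.

  Conversely take a nonzero \<open>f\<close> with \<open>\<Sum> f_l h_l \<in> U\<close>, with
  leading monomial \<open>X^e e_i\<close>, and put \<open>M = X^e lm h_i\<close>. Nothing in the sum
  exceeds \<open>M\<close>. Either the coefficient of \<open>M\<close> cancels, and then some
  \<open>lm h_l\<close> with \<open>l > i\<close> divides \<open>M\<close>; or \<open>M\<close> is
  the leading monomial of an element of \<open>U\<close>, and then the leading monomial of an
  element of \<open>us\<close> divides \<open>M\<close>. In either case \<open>lm g_j\<close>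
  divides \<open>M\<close> for some \<open>j > i\<close>, hence so does \<open>m_ij\<close>, and the
  leading monomial of the projected \<open>S_ij\<close> divides \<open>X^e e_i\<close>
  (\<open>syzygy_lm_covered\<close>).

  The induced order is again a monomial order (\<open>monomial_order_induced\<close>), and a
  Groebner basis of any submodule fits the same scheme with \<open>U = 0\<close> and \<open>us =
  []\<close> (\<open>groebner_basis_schreyer_syzygies\<close>), so the construction can be repeated.
\<close>

section \<open>Coefficients and supports\<close>

text \<open>Monomials are pairs; quantified monomials are kept as single variables.\<close>

declare split_paired_All [simp del] split_paired_Ex [simp del]

lemma mcoeff_0 [simp]: "mcoeff 0 u = 0"
  by (simp add: mcoeff_def)

lemma mcoeff_add [simp]: "mcoeff (f + g) u = mcoeff f u + mcoeff g u"
  by (simp add: mcoeff_def lookup_add)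

lemma mcoeff_diff [simp]: "mcoeff (f - g) u = mcoeff f u - mcoeff g u"
  by (simp add: mcoeff_def lookup_minus)

lemma mcoeff_sum: "mcoeff (\<Sum>x\<in>A. f x) u = (\<Sum>x\<in>A. mcoeff (f x) u)"
  by (induction A rule: infinite_finite_induct) auto

lemma mcoeff_single [simp]:
  "mcoeff (Poly_Mapping.single i (Poly_Mapping.single a k)) u = (if u = (a, i) then k else 0)"
  by (auto simp: mcoeff_def lookup_single when_def prod_eq_iff)

lemma mcoeff_kscale [simp]: "mcoeff (kscale k f) u = k * mcoeff f u"
  by (simp add: mcoeff_def kscale_def flip: mult_map_scale_conv_mult)
    (simp add: Poly_Mapping.map.rep_eq when_def)

lemma vec_eqI: "(\<And>u. mcoeff f u = mcoeff g u) \<Longrightarrow> f = g"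
  by (rule poly_mapping_eqI, rule poly_mapping_eqI) (metis mcoeff_def fst_conv snd_conv)

lemma in_supp_iff: "u \<in> supp f \<longleftrightarrow> mcoeff f u \<noteq> 0"
  by (simp add: supp_def)

lemma in_supp_Pair_iff: "(a, i) \<in> supp f \<longleftrightarrow> a \<in> Poly_Mapping.keys (Poly_Mapping.lookup f i)"
  by (simp add: supp_def mcoeff_def in_keys_iff)

lemma supp_eq_empty_iff [simp]: "supp f = {} \<longleftrightarrow> f = 0"
  by (auto simp: supp_def intro: vec_eqI)

lemma supp_single:
  "u \<in> supp (Poly_Mapping.single i p) \<Longrightarrow> snd u = i \<and> fst u \<in> Poly_Mapping.keys p"
  by (cases u) (auto simp: in_supp_Pair_iff lookup_single when_def split: if_splits)

lemma supp_add: "supp (f + g) \<subseteq> supp f \<union> supp g"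
  by (auto simp: supp_def)

lemma supp_diff: "supp (f - g) \<subseteq> supp f \<union> supp g"
  by (auto simp: supp_def)

lemma finite_supp [simp]: "finite (supp f)"
proof -
  have "supp f \<subseteq> (\<Union>i\<in>Poly_Mapping.keys f.
      (\<lambda>a. (a, i)) ` Poly_Mapping.keys (Poly_Mapping.lookup f i))"
    by (auto simp: in_supp_Pair_iff in_keys_iff image_iff)
  then show ?thesis
    by (rule finite_subset) auto
qed

lemma free_mod_iff: "f \<in> free_mod m \<longleftrightarrow> supp f \<subseteq> Mon m"
proof
  assume "f \<in> free_mod m"
  moreover have "snd u \<in> Poly_Mapping.keys f" if "u \<in> supp f" for u
    using that unfolding in_supp_iff mcoeff_def in_keys_iff by (metis lookup_zero)
  ultimately show "supp f \<subseteq> Mon m"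
    by (auto simp: free_mod_def Mon_def)
next
  assume *: "supp f \<subseteq> Mon m"
  have "i < m" if "i \<in> Poly_Mapping.keys f" for i
  proof -
    have "Poly_Mapping.lookup f i \<noteq> 0"
      using that by (simp add: in_keys_iff)
    then obtain a where "Poly_Mapping.lookup (Poly_Mapping.lookup f i) a \<noteq> 0"
      by (metis lookup_zero poly_mapping_eqI)
    then have "a \<in> Poly_Mapping.keys (Poly_Mapping.lookup f i)"
      by (simp add: in_keys_iff)
    then show ?thesis
      using * by (auto simp: Mon_def simp flip: in_supp_Pair_iff dest!: subsetD)
  qed
  then show "f \<in> free_mod m"
    by (auto simp: free_mod_def)
qed

lemma mon_mult_inj [simp]: "mon_mult c u = mon_mult c v \<longleftrightarrow> u = v"
  by (auto simp: mon_mult_def prod_eq_iff)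

lemma snd_mon_mult [simp]: "snd (mon_mult c u) = snd u"
  by (simp add: mon_mult_def)

lemma mon_mult_0 [simp]: "mon_mult 0 u = u"
  by (simp add: mon_mult_def)

lemma mon_mult_mon_mult: "mon_mult a (mon_mult b u) = mon_mult (a + b) u"
  by (simp add: mon_mult_def add_ac)

lemma mon_mult_in_Mon [simp]: "mon_mult c u \<in> Mon m \<longleftrightarrow> u \<in> Mon m"
  by (simp add: Mon_def)

lemma mon_dvd_mon_mult [simp]: "mon_dvd u (mon_mult c u)"
  by (auto simp: mon_dvd_def)

lemma mon_dvd_quot: "mon_dvd u v \<Longrightarrow> mon_mult (fst v - fst u) u = v"
  by (auto simp: mon_dvd_def mon_mult_def)

lemma lookup_term_mult:
  fixes p :: "('x \<Rightarrow>\<^sub>0 nat) \<Rightarrow>\<^sub>0 'k::field"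
  shows "Poly_Mapping.lookup (Poly_Mapping.single c k * p) (c + a) = k * Poly_Mapping.lookup p a"
  by (simp add: lookup_mult lookup_single when_mult)

lemma mcoeff_smul_term [simp]:
  "mcoeff (smul (Poly_Mapping.single c k) f) (mon_mult c u) = k * mcoeff f u"
  by (simp add: mcoeff_def mon_mult_def lookup_term_mult)

lemma supp_smul:
  assumes "w \<in> supp (smul p f)"
  obtains c u where "c \<in> Poly_Mapping.keys p" "u \<in> supp f" "w = mon_mult c u"
proof -
  have "fst w \<in> Poly_Mapping.keys (p * Poly_Mapping.lookup f (snd w))"
    using assms by (simp add: in_supp_iff mcoeff_def in_keys_iff)
  then obtain c a where "c \<in> Poly_Mapping.keys p"
    "a \<in> Poly_Mapping.keys (Poly_Mapping.lookup f (snd w))" "fst w = c + a"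
    using keys_mult by blast
  then show ?thesis
    by (intro that[of c "(a, snd w)"]) (auto simp: in_supp_Pair_iff mon_mult_def prod_eq_iff)
qed

lemma subspace_free_mod: "Rmod.subspace (free_mod m)"
proof (rule Rmod.subspaceI)
  show "x + y \<in> free_mod m" if "x \<in> free_mod m" "y \<in> free_mod m" for x y :: "('x, 'k::field) vec"
    using that supp_add[of x y] unfolding free_mod_iff by blast
  show "smul c x \<in> free_mod m" if "x \<in> free_mod m" for c and x :: "('x, 'k::field) vec"
    using that unfolding free_mod_iff by (auto elim!: supp_smul)
qed (simp add: free_mod_def)

lemma supp_smul_term:
  assumes "k \<noteq> 0"
  shows "supp (smul (Poly_Mapping.single c k) f) = mon_mult c ` supp f"
proof
  show "supp (smul (Poly_Mapping.single c k) f) \<subseteq> mon_mult c ` supp f"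
    using assms by (auto elim!: supp_smul)
  show "mon_mult c ` supp f \<subseteq> supp (smul (Poly_Mapping.single c k) f)"
    using assms by (auto simp: in_supp_iff)
qed

text \<open>
  Spans of monomials, over the field and over the ring, are described by their supports. This turns
  both sides of the defining equation of a Groebner basis into sets of monomials.
\<close>

lemma vec_eq_sum_monomials: "f = (\<Sum>u\<in>supp f. kscale (mcoeff f u) (mon_vec u))"
proof (rule vec_eqI)
  fix w
  have "mcoeff (\<Sum>u\<in>supp f. kscale (mcoeff f u) (mon_vec u)) w
      = (\<Sum>u\<in>supp f. if u = w then mcoeff f w else 0)"
    unfolding mcoeff_sum by (rule sum.cong) (auto simp: mon_vec_def)
  also have "\<dots> = mcoeff f w"
    by (auto simp: in_supp_iff)
  finally show "mcoeff f w = mcoeff (\<Sum>u\<in>supp f. kscale (mcoeff f u) (mon_vec u)) w"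
    by simp
qed

lemma supp_mon_vec [simp]: "supp (mon_vec u :: ('x, 'k::field) vec) = {u}"
  by (auto simp: supp_def mon_vec_def)

lemma kvec_span_mon_vec:
  fixes B :: "'x mmon set"
  shows "kvec.span ((mon_vec :: _ \<Rightarrow> ('x, 'k::field) vec) ` B) = {x. supp x \<subseteq> B}"
proof
  have "kvec.subspace {x :: ('x, 'k) vec. supp x \<subseteq> B}"
  proof (rule kvec.subspaceI)
    show "x + y \<in> {x. supp x \<subseteq> B}" if "x \<in> {x. supp x \<subseteq> B}" "y \<in> {x. supp x \<subseteq> B}"
      for x y :: "('x, 'k) vec"
      using that supp_add[of x y] by blast
  qed (auto simp: supp_def)
  then show "kvec.span ((mon_vec :: _ \<Rightarrow> ('x, 'k) vec) ` B) \<subseteq> {x. supp x \<subseteq> B}"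
    by (intro kvec.span_minimal) auto
  show "{x. supp x \<subseteq> B} \<subseteq> kvec.span ((mon_vec :: _ \<Rightarrow> ('x, 'k) vec) ` B)"
  proof
    fix x :: "('x, 'k) vec" assume "x \<in> {x. supp x \<subseteq> B}"
    then have "(\<Sum>u\<in>supp x. kscale (mcoeff x u) (mon_vec u)) \<in> kvec.span (mon_vec ` B)"
      by (intro kvec.span_sum kvec.span_scale kvec.span_base) auto
    then show "x \<in> kvec.span (mon_vec ` B)"
      by (simp flip: vec_eq_sum_monomials)
  qed
qed

lemma Rmod_span_mon_vec:
  fixes B :: "'x mmon set"
  shows "Rmod.span ((mon_vec :: _ \<Rightarrow> ('x, 'k::field) vec) ` B)
       = {x. supp x \<subseteq> {w. \<exists>b\<in>B. mon_dvd b w}}"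
proof
  have "Rmod.subspace {x :: ('x, 'k) vec. supp x \<subseteq> {w. \<exists>b\<in>B. mon_dvd b w}}"
  proof (rule Rmod.subspaceI, goal_cases)
    case 1
    show ?case
      by (simp add: supp_def)
  next
    case (2 x y)
    then show ?case
      using supp_add[of x y] by blast
  next
    case (3 p x)
    have "\<exists>b\<in>B. mon_dvd b w" if "w \<in> supp (smul p x)" for w
      using that
    proof (rule supp_smul)
      fix c u assume "u \<in> supp x" "w = mon_mult c u"
      moreover then obtain b e where "b \<in> B" "u = mon_mult e b"
        using 3 by (auto simp: mon_dvd_def)
      ultimately show ?thesis
        by (metis mon_dvd_mon_mult mon_mult_mon_mult)
    qed
    then show ?case
      by blast
  qed
  then show "Rmod.span ((mon_vec :: _ \<Rightarrow> ('x, 'k) vec) ` B)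
      \<subseteq> {x. supp x \<subseteq> {w. \<exists>b\<in>B. mon_dvd b w}}"
    by (intro Rmod.span_minimal) (auto simp: mon_dvd_def intro!: bexI exI[of _ 0])
  show "{x. supp x \<subseteq> {w. \<exists>b\<in>B. mon_dvd b w}}
      \<subseteq> Rmod.span ((mon_vec :: _ \<Rightarrow> ('x, 'k) vec) ` B)"
  proof
    fix x :: "('x, 'k) vec" assume x: "x \<in> {x. supp x \<subseteq> {w. \<exists>b\<in>B. mon_dvd b w}}"
    have "mon_vec w \<in> Rmod.span ((mon_vec :: _ \<Rightarrow> ('x, 'k) vec) ` B)" if "w \<in> supp x" for w
    proof -
      from x that obtain b c where b: "b \<in> B" "w = mon_mult c b"
        by (auto simp: mon_dvd_def)
      have "mon_vec w = smul (Poly_Mapping.single c 1) (mon_vec b :: ('x, 'k) vec)"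
        by (auto simp: mon_vec_def b mon_mult_def lookup_single when_def mult_single
            intro!: poly_mapping_eqI)
      then show ?thesis
        using b by (auto intro: Rmod.span_scale Rmod.span_base)
    qed
    then have "(\<Sum>u\<in>supp x. kscale (mcoeff x u) (mon_vec u)) \<in> Rmod.span (mon_vec ` B)"
      by (auto simp: kscale_def intro!: Rmod.span_sum Rmod.span_scale)
    then show "x \<in> Rmod.span (mon_vec ` B)"
      by (simp flip: vec_eq_sum_monomials)
  qed
qed

lemma lm_gen_eq: "lm_gen r G = {x. supp x \<subseteq> {w. \<exists>g\<in>G. mon_dvd (lm r g) w}}"
  using Rmod_span_mon_vec[of "lm r ` G"] by (simp add: lm_gen_def image_image)

lemma lm_space_eq: "lm_space r W = {x. supp x \<subseteq> lm r ` (W - {0})}"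
  using kvec_span_mon_vec[of "lm r ` (W - {0})"] by (simp add: lm_space_def image_image)


section \<open>Monomial orders and leading monomials\<close>

locale mon_order =
  fixes m :: nat and r :: "'x mmon rel"
  assumes monomial_order: "monomial_order m r"
begin

lemma wf_strict: "wf (r - Id)"
  and ord_refl: "u \<in> Mon m \<Longrightarrow> (u, u) \<in> r"
  and ord_total: "u \<in> Mon m \<Longrightarrow> v \<in> Mon m \<Longrightarrow> (u, v) \<in> r \<or> (v, u) \<in> r"
  and ord_antisym: "(u, v) \<in> r \<Longrightarrow> (v, u) \<in> r \<Longrightarrow> u = v"
  and ord_trans: "(u, v) \<in> r \<Longrightarrow> (v, w) \<in> r \<Longrightarrow> (u, w) \<in> r"
  and ord_mult: "(u, v) \<in> r \<Longrightarrow> (mon_mult c u, mon_mult c v) \<in> r"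
proof -
  have *: "wf (r - Id)" "refl_on (Mon m) r" "trans r" "antisym r" "total_on (Mon m) r"
    using monomial_order by (auto simp: monomial_order_def order_on_defs)
  show "wf (r - Id)"
    by (fact *)
  show "(u, u) \<in> r" if "u \<in> Mon m"
    using * that by (simp add: refl_onD)
  then show "(u, v) \<in> r \<or> (v, u) \<in> r" if "u \<in> Mon m" "v \<in> Mon m"
    using * that by (cases "u = v") (auto simp: total_on_def)
  show "u = v" if "(u, v) \<in> r" "(v, u) \<in> r"
    using * that by (meson antisymD)
  show "(u, w) \<in> r" if "(u, v) \<in> r" "(v, w) \<in> r"
    using * that by (meson transD)
  show "(mon_mult c u, mon_mult c v) \<in> r" if "(u, v) \<in> r"
    using that monomial_order by (simp add: monomial_order_def)
qed

lemma ord_le_less_trans: "(u, v) \<in> r \<Longrightarrow> (v, w) \<in> r - Id \<Longrightarrow> (u, w) \<in> r - Id"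
  using ord_trans[of u v w] ord_antisym[of u v] by auto

lemma finite_has_greatest:
  assumes "finite A" "A \<noteq> {}" "A \<subseteq> Mon m"
  shows "\<exists>u\<in>A. \<forall>v\<in>A. (v, u) \<in> r"
  using assms
proof (induction rule: finite_ne_induct)
  case (singleton x)
  then show ?case
    by (simp add: ord_refl)
next
  case (insert x A)
  then obtain u where u: "u \<in> A" "\<forall>v\<in>A. (v, u) \<in> r"
    by auto
  with insert.prems ord_total[of x u] ord_refl[of x] show ?case
    by (auto intro: ord_trans)
qed

lemma lm_eqI:
  assumes "u \<in> supp f" "\<And>v. v \<in> supp f \<Longrightarrow> (v, u) \<in> r"
  shows "lm r f = u"
  unfolding lm_def using assms ord_antisym by (intro the_equality) auto

lemma lm_in_supp_and_max:
  assumes "f \<in> free_mod m" "f \<noteq> 0"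
  shows "lm r f \<in> supp f \<and> (\<forall>v\<in>supp f. (v, lm r f) \<in> r)"
proof -
  obtain u where "u \<in> supp f" "\<forall>v\<in>supp f. (v, u) \<in> r"
    using finite_has_greatest[of "supp f"] assms by (auto simp: free_mod_iff)
  moreover then have "lm r f = u"
    by (intro lm_eqI) auto
  ultimately show ?thesis
    by simp
qed

lemma lm_in_supp: "f \<in> free_mod m \<Longrightarrow> f \<noteq> 0 \<Longrightarrow> lm r f \<in> supp f"
  using lm_in_supp_and_max by blast

lemma lm_max: "f \<in> free_mod m \<Longrightarrow> v \<in> supp f \<Longrightarrow> (v, lm r f) \<in> r"
  using lm_in_supp_and_max[of f] by (cases "f = 0") (auto simp: supp_def)

lemma lm_in_Mon: "f \<in> free_mod m \<Longrightarrow> f \<noteq> 0 \<Longrightarrow> lm r f \<in> Mon m"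
  using lm_in_supp free_mod_iff by blast

lemma lc_nonzero: "f \<in> free_mod m \<Longrightarrow> f \<noteq> 0 \<Longrightarrow> lc r f \<noteq> 0"
  using lm_in_supp by (simp add: lc_def in_supp_iff)

lemma lm_smul_term:
  assumes "f \<in> free_mod m" "f \<noteq> 0" "k \<noteq> 0"
  shows "lm r (smul (Poly_Mapping.single c k) f) = mon_mult c (lm r f)"
  using assms by (intro lm_eqI) (auto simp: supp_smul_term lm_in_supp lm_max ord_mult)

text \<open>
  The common reason why a division step and an S-polynomial lower the order: two elements bounded by
  the same monomial \<open>u\<close> and agreeing at \<open>u\<close> are subtracted.
\<close>

lemma supp_diff_cancel:
  assumes "\<And>v. v \<in> supp f \<Longrightarrow> (v, u) \<in> r" "\<And>v. v \<in> supp g \<Longrightarrow> (v, u) \<in> r"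
    and "mcoeff f u = mcoeff g u" and "w \<in> supp (f - g)"
  shows "(w, u) \<in> r - Id"
proof -
  have "(w, u) \<in> r"
    using assms(1,2,4) supp_diff[of f g] by blast
  moreover have "w \<noteq> u"
    using assms(3,4) by (auto simp: in_supp_iff)
  ultimately show ?thesis
    by simp
qed

lemma supp_reduction_step:
  assumes "f \<in> free_mod m" "f \<noteq> 0" "g \<in> free_mod m" "g \<noteq> 0" "mon_dvd (lm r g) (lm r f)"
    and "w \<in> supp (f - smul (lt_quot r f g) g)"
  shows "(w, lm r f) \<in> r - Id"
proof (rule supp_diff_cancel[OF _ _ _ assms(6)])
  let ?c = "fst (lm r f) - fst (lm r g)"
  have eq: "lm r f = mon_mult ?c (lm r g)"
    using assms(5) by (simp add: mon_dvd_quot)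
  have nz: "lc r f \<noteq> 0" "lc r g \<noteq> 0"
    using assms by (auto simp: lc_nonzero)
  show "(v, lm r f) \<in> r" if "v \<in> supp f" for v
    using that assms by (simp add: lm_max)
  show "(v, lm r f) \<in> r" if "v \<in> supp (smul (lt_quot r f g) g)" for v
  proof -
    have "v \<in> mon_mult ?c ` supp g"
      using that nz by (simp add: lt_quot_def supp_smul_term)
    then obtain u where "u \<in> supp g" "v = mon_mult ?c u"
      by blast
    then show ?thesis
      using assms by (subst eq) (simp add: ord_mult lm_max)
  qed
  have "mcoeff (smul (lt_quot r f g) g) (mon_mult ?c (lm r g)) = lc r f / lc r g * mcoeff g (lm r g)"
    by (simp only: lt_quot_def mcoeff_smul_term)
  then have "mcoeff (smul (lt_quot r f g) g) (lm r f) = lc r f / lc r g * mcoeff g (lm r g)"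
    by (simp flip: eq)
  also have "\<dots> = mcoeff f (lm r f)"
    using nz by (simp add: lc_def)
  finally show "mcoeff f (lm r f) = mcoeff (smul (lt_quot r f g) g) (lm r f)"
    by simp
qed

end

lemma lin_comb_add: "lin_comb gs (f + g) = lin_comb gs f + lin_comb gs g"
  by (simp add: lin_comb_def lookup_add Rmod.scale_left_distrib sum.distrib)

lemma lin_comb_diff: "lin_comb gs (f - g) = lin_comb gs f - lin_comb gs g"
  by (simp add: lin_comb_def lookup_minus Rmod.scale_left_diff_distrib sum_subtractf)

lemma lin_comb_0 [simp]: "lin_comb gs 0 = 0"
  by (simp add: lin_comb_def)

lemma lin_comb_smul: "lin_comb gs (smul p f) = smul p (lin_comb gs f)"
  by (simp add: lin_comb_def Rmod.scale_sum_right)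

lemma lin_comb_single:
  assumes "i < length gs"
  shows "lin_comb gs (Poly_Mapping.single i p) = smul p (gs ! i)"
proof -
  have "lin_comb gs (Poly_Mapping.single i p)
      = (\<Sum>k<length gs. if k = i then smul p (gs ! i) else 0)"
    unfolding lin_comb_def by (rule sum.cong) (auto simp: lookup_single when_def)
  then show ?thesis
    using assms by simp
qed

lemma lin_comb_in_subspace:
  assumes "Rmod.subspace W" "set gs \<subseteq> W"
  shows "lin_comb gs f \<in> W"
  unfolding lin_comb_def using assms
  by (intro Rmod.subspace_sum Rmod.subspace_scale) auto

lemma supp_lin_comb:
  assumes "w \<in> supp (lin_comb gs f)"
  obtains c i u where "(c, i) \<in> supp f" "i < length gs" "u \<in> supp (gs ! i)" "w = mon_mult c u"
proof -
  have "(\<Sum>i<length gs. mcoeff (smul (Poly_Mapping.lookup f i) (gs ! i)) w) \<noteq> 0"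
    using assms by (simp add: in_supp_iff lin_comb_def mcoeff_sum)
  then obtain i where "i < length gs" "w \<in> supp (smul (Poly_Mapping.lookup f i) (gs ! i))"
    by (auto simp: in_supp_iff elim: sum.not_neutral_contains_not_neutral)
  then show ?thesis
    using that unfolding in_supp_Pair_iff by (blast elim: supp_smul)
qed


section \<open>Division and Groebner bases\<close>

context mon_order
begin

text \<open>
  A run of the division algorithm meets strictly decreasing leading monomials, so every term of a
  quotient is bounded by a monomial of the dividend. The bound is a monomial in the support of
  \<open>f\<close> instead of \<open>lm r f\<close> because the latter is a junk value when the
  remaining element is \<open>0\<close>; the induction passes through that case.
\<close>

lemma division_standard_representation:
  assumes "division r gs ok f a" and "f \<in> free_mod m" and "set gs \<subseteq> free_mod m - {0}"
    and "\<And>f k. ok f k \<Longrightarrow> cancels r gs f k"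
  shows "a \<in> free_mod (length gs) \<and> lin_comb gs a = f \<and>
    (\<forall>(c, k) \<in> supp a. \<exists>u \<in> supp f. (mon_mult c (lm r (gs ! k)), u) \<in> r)"
  using assms(1, 2)
proof (induction rule: division.induct)
  case zero
  then show ?case
    by (auto simp: supp_def free_mod_def)
next
  case (step f k a)
  let ?q = "lt_quot r f (gs ! k)"
  let ?f' = "f - smul ?q (gs ! k)"
  have k: "k < length gs" and dvd: "mon_dvd (lm r (gs ! k)) (lm r f)"
    using assms(4)[OF step.hyps(2)] by (auto simp: cancels_def)
  have g: "gs ! k \<in> free_mod m" "gs ! k \<noteq> 0"
    using k assms(3) nth_mem by fastforce+
  have f': "?f' \<in> free_mod m"
    using step.prems g by (intro Rmod.subspace_diff Rmod.subspace_scale subspace_free_mod)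
  note IH = step.IH[OF f']
  have "Poly_Mapping.single k ?q \<in> free_mod (length gs)"
    using k by (simp add: free_mod_def)
  then have "a + Poly_Mapping.single k ?q \<in> free_mod (length gs)"
    using IH by (intro Rmod.subspace_add subspace_free_mod) auto
  moreover have "lin_comb gs (a + Poly_Mapping.single k ?q) = f"
    using IH k by (simp add: lin_comb_add lin_comb_single)
  moreover have "\<exists>u\<in>supp f. (mon_mult c (lm r (gs ! l)), u) \<in> r"
    if cl: "(c, l) \<in> supp (a + Poly_Mapping.single k ?q)" for c l
  proof (rule bexI)
    show "lm r f \<in> supp f"
      using step by (intro lm_in_supp) auto
    have "(c, l) \<in> supp a \<or> l = k \<and> c \<in> Poly_Mapping.keys ?q"
      using cl supp_add supp_single[of "(c, l)" k ?q] by fastforce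
    then show "(mon_mult c (lm r (gs ! l)), lm r f) \<in> r"
    proof
      assume "(c, l) \<in> supp a"
      then obtain u where u: "u \<in> supp ?f'" "(mon_mult c (lm r (gs ! l)), u) \<in> r"
        using IH by blast
      then have "(u, lm r f) \<in> r"
        using supp_reduction_step[OF step.prems step.hyps(1) g dvd] by blast
      with u show ?thesis
        by (blast intro: ord_trans)
    next
      assume "l = k \<and> c \<in> Poly_Mapping.keys ?q"
      then have "l = k" "mon_mult c (lm r (gs ! k)) = lm r f"
        using dvd by (auto simp: lt_quot_def mon_dvd_quot split: if_splits)
      then show ?thesis
        using step by (simp add: ord_refl lm_in_Mon)
    qed
  qed
  ultimately show ?case
    by blast
qed

text \<open>
  Division ends because every step lowers the leading monomial, and it never gets stuck as long as
  some admissible divisor exists for each nonzero element.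
\<close>

lemma division_exists:
  assumes W: "Rmod.subspace W" "W \<subseteq> free_mod m" "set gs \<subseteq> W - {0}"
    and ok: "\<And>f k. ok f k \<Longrightarrow> cancels r gs f k" "\<And>f. f \<in> W \<Longrightarrow> f \<noteq> 0 \<Longrightarrow> \<exists>k. ok f k"
    and "f \<in> W"
  shows "\<exists>a. division r gs ok f a"
proof -
  have "f \<in> W \<longrightarrow> f \<noteq> 0 \<longrightarrow> lm r f = u \<longrightarrow> (\<exists>a. division r gs ok f a)" for u f
  proof (induction u arbitrary: f rule: wf_induct_rule[OF wf_strict])
    case (1 u)
    show ?case
    proof (intro impI)
      assume f: "f \<in> W" "f \<noteq> 0" "lm r f = u"
      then obtain k where k: "ok f k"
        using ok(2) by blast
      let ?f' = "f - smul (lt_quot r f (gs ! k)) (gs ! k)"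
      have dvd: "mon_dvd (lm r (gs ! k)) (lm r f)" and "gs ! k \<in> set gs"
        using ok(1)[OF k] by (auto simp: cancels_def)
      then have g: "gs ! k \<in> W" "gs ! k \<noteq> 0"
        using W(3) by auto
      have f': "?f' \<in> W"
        using f g W by (intro Rmod.subspace_diff Rmod.subspace_scale)
      have "\<exists>a. division r gs ok ?f' a"
      proof (cases "?f' = 0")
        case True
        then show ?thesis
          by (metis division.zero)
      next
        case False
        then have "lm r ?f' \<in> supp ?f'"
          using f' W by (intro lm_in_supp) auto
        moreover have "f \<in> free_mod m" "gs ! k \<in> free_mod m"
          using f g W by auto
        ultimately have "(lm r ?f', u) \<in> r - Id"
          using supp_reduction_step[OF _ f(2) _ g(2) dvd] f(3) by simp
        then show ?thesis
          using 1 f' False by blast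
      qed
      then show "\<exists>a. division r gs ok f a"
        using division.step[OF f(2), of ok k] k by blast
    qed
  qed
  then show ?thesis
    using \<open>f \<in> W\<close> division.zero by metis
qed

text \<open>
  The working form of the definition. Since spans of monomials are determined by supports, the
  equation between the two modules of leading monomials says that the monomials divisible by some
  \<open>lm g\<close> are exactly the leading monomials of \<open>W\<close>. That \<open>G\<close>
  generates \<open>W\<close> then follows by division, which cannot get stuck.
\<close>

lemma groebner_basis_iff:
  assumes W: "Rmod.subspace W" "W \<subseteq> free_mod m"
  shows "groebner_basis r W G \<longleftrightarrow>
    finite G \<and> 0 \<notin> G \<and> G \<subseteq> W \<and> (\<forall>f \<in> W - {0}. \<exists>g \<in> G. mon_dvd (lm r g) (lm r f))"
    (is "?L \<longleftrightarrow> ?R")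
proof
  assume ?L
  then have G: "finite G" "0 \<notin> G" "Rmod.span G = W" and eq: "lm_gen r G = lm_space r W"
    by (auto simp: groebner_basis_def)
  have "\<exists>g\<in>G. mon_dvd (lm r g) (lm r f)" if "f \<in> W - {0}" for f
  proof -
    have "mon_vec (lm r f) \<in> lm_gen r G"
      using that unfolding eq lm_space_eq by simp
    then show ?thesis
      by (auto simp: lm_gen_eq)
  qed
  then show ?R
    using G Rmod.span_superset by blast
next
  assume ?R
  then have fin: "finite G" and R: "0 \<notin> G" "G \<subseteq> W"
    and dvd: "\<forall>f \<in> W - {0}. \<exists>g \<in> G. mon_dvd (lm r g) (lm r f)"
    by simp_all
  have "lm_gen r G = lm_space r W"
  proof -
    have "(\<exists>g\<in>G. mon_dvd (lm r g) w) \<longleftrightarrow> w \<in> lm r ` (W - {0})" for w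
    proof
      assume "\<exists>g\<in>G. mon_dvd (lm r g) w"
      then obtain g c where g: "g \<in> G" "w = mon_mult c (lm r g)"
        by (auto simp: mon_dvd_def)
      let ?f = "smul (Poly_Mapping.single c 1) g"
      have "g \<in> free_mod m" "g \<noteq> 0" "g \<in> W"
        using R W g by auto
      then have "lm r ?f = w" "?f \<in> W"
        using g W by (auto simp: lm_smul_term Rmod.subspace_scale)
      moreover have "?f \<noteq> 0"
        using supp_smul_term[of 1 c g] \<open>g \<noteq> 0\<close> by (metis image_is_empty one_neq_zero supp_eq_empty_iff)
      ultimately show "w \<in> lm r ` (W - {0})"
        by blast
    qed (use dvd in blast)
    then show ?thesis
      by (simp add: lm_gen_eq lm_space_eq)
  qed
  moreover have "Rmod.span G = W"
  proof
    show "Rmod.span G \<subseteq> W"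
      using R W by (intro Rmod.span_minimal) auto
    show "W \<subseteq> Rmod.span G"
    proof
      fix f assume f: "f \<in> W"
      obtain gs where gs: "set gs = G"
        using finite_list[OF fin] by blast
      have "\<exists>k. cancels r gs f k" if f0: "f \<in> W" "f \<noteq> 0" for f
      proof -
        obtain g where "g \<in> G" "mon_dvd (lm r g) (lm r f)"
          using dvd f0 by blast
        moreover from \<open>g \<in> G\<close> have "g \<in> set gs"
          by (simp add: gs)
        then obtain k where "k < length gs" "gs ! k = g"
          unfolding in_set_conv_nth by blast
        ultimately have "cancels r gs f k"
          by (simp add: cancels_def)
        then show ?thesis ..
      qed
      then obtain a where "division r gs (cancels r gs) f a"
        using division_exists[OF W, of gs "cancels r gs" f] f R gs by auto
      moreover have "f \<in> free_mod m" "set gs \<subseteq> free_mod m - {0}"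
        using f W R gs by auto
      ultimately have "lin_comb gs a = f"
        using division_standard_representation[of gs "cancels r gs" f a] by simp
      then show "f \<in> Rmod.span G"
        using lin_comb_in_subspace[of "Rmod.span G" gs a] gs Rmod.span_superset by blast
    qed
  qed
  ultimately show ?L
    using R fin by (simp add: groebner_basis_def)
qed

end


section \<open>The induced order\<close>

text \<open>
  The leading monomial of \<open>X^a g_i\<close> for nonzero \<open>g_i\<close>, where
  \<open>u\<close> encodes \<open>X^a e_i\<close>. With this form the induced order is visibly the
  lexicographic comparison of images and reversed indices.
\<close>

definition image_lm :: "'x mmon rel \<Rightarrow> ('x, 'k::field) vec list \<Rightarrow> 'x mmon \<Rightarrow> 'x mmon" where
  "image_lm r gs u = mon_mult (fst u) (lm r (gs ! snd u))"

lemma image_lm_mon_mult: "image_lm r gs (mon_mult c u) = mon_mult c (image_lm r gs u)"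
  by (simp add: image_lm_def mon_mult_def add_ac)

lemma image_lm_inj: "image_lm r gs u = image_lm r gs v \<Longrightarrow> snd u = snd v \<Longrightarrow> u = v"
  by (simp add: image_lm_def mon_mult_def prod_eq_iff)

context mon_order
begin

lemma image_lm_in_Mon:
  assumes "set gs \<subseteq> free_mod m - {0}" "u \<in> Mon (length gs)"
  shows "image_lm r gs u \<in> Mon m"
proof -
  have "gs ! snd u \<in> free_mod m - {0}"
    using subsetD[OF assms(1), of "gs ! snd u"] assms(2) by (simp add: Mon_def)
  then show ?thesis
    by (simp add: image_lm_def lm_in_Mon)
qed

lemma induced_order_iff:
  assumes "set gs \<subseteq> free_mod m - {0}"
  shows "(u, v) \<in> induced_order r gs \<longleftrightarrow> u \<in> Mon (length gs) \<and> v \<in> Mon (length gs) \<and>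
    (u = v \<or> (image_lm r gs u, image_lm r gs v) \<in> r - Id \<or>
      image_lm r gs u = image_lm r gs v \<and> snd v < snd u)"
proof -
  have "lm r (smul (Poly_Mapping.single (fst w) 1) (gs ! snd w)) = image_lm r gs w"
    if "w \<in> Mon (length gs)" for w
  proof -
    have "gs ! snd w \<in> free_mod m - {0}"
      using subsetD[OF assms, of "gs ! snd w"] that by (simp add: Mon_def)
    then show ?thesis
      by (simp add: lm_smul_term image_lm_def)
  qed
  then show ?thesis
    by (auto simp: induced_order_def induced_less_def Let_def)
qed

lemma monomial_order_induced:
  assumes gs: "set gs \<subseteq> free_mod m - {0}"
  shows "monomial_order (length gs) (induced_order r gs)"
proof -
  let ?q = "induced_order r gs" and ?M = "Mon (length gs)" and ?l = "image_lm r gs"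
  note iff = induced_order_iff[OF gs]
  have "?q \<subseteq> ?M \<times> ?M"
    by (auto simp: induced_order_def)
  moreover have "refl_on ?M ?q"
    by (rule refl_onI) (simp add: iff)
  moreover have "trans ?q"
  proof (rule transI)
    fix u v w :: "'x mmon" assume *: "(u, v) \<in> ?q" "(v, w) \<in> ?q"
    then have "?l u = ?l v \<or> (?l u, ?l v) \<in> r" "?l v = ?l w \<or> (?l v, ?l w) \<in> r"
      by (auto simp: iff)
    with * show "(u, w) \<in> ?q"
      unfolding iff using ord_trans[of "?l u" "?l v" "?l w"] ord_antisym by fastforce
  qed
  moreover have "antisym ?q"
  proof (rule antisymI)
    fix u v :: "'x mmon" assume "(u, v) \<in> ?q" "(v, u) \<in> ?q"
    then show "u = v"
      unfolding iff using ord_antisym by fastforce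
  qed
  moreover have "total_on ?M ?q"
  proof (rule total_onI)
    fix u v :: "'x mmon" assume uv: "u \<in> ?M" "v \<in> ?M" "u \<noteq> v"
    show "(u, v) \<in> ?q \<or> (v, u) \<in> ?q"
    proof (cases "?l u = ?l v")
      case True
      then have "snd u \<noteq> snd v"
        using uv image_lm_inj by metis
      then show ?thesis
        using uv True by (auto simp: iff)
    next
      case False
      then show ?thesis
        using uv ord_total[OF uv(1)[THEN image_lm_in_Mon[OF gs]] uv(2)[THEN image_lm_in_Mon[OF gs]]]
        by (auto simp: iff)
    qed
  qed
  moreover have "wf (?q - Id)"
  proof (rule wf_subset)
    \<comment> \<open>Larger indices are smaller in the order; this is well-founded because indices are bounded.\<close>
    show "wf (inv_image ((r - Id) <*lex*> measure (\<lambda>i. length gs - i)) (\<lambda>u. (?l u, snd u)))"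
      by (intro wf_inv_image wf_lex_prod wf_strict wf_measure)
    show "?q - Id \<subseteq>
        inv_image ((r - Id) <*lex*> measure (\<lambda>i. length gs - i)) (\<lambda>u. (?l u, snd u))"
    proof (rule subrelI)
      fix u v :: "'x mmon" assume "(u, v) \<in> ?q - Id"
      moreover then have "snd u < length gs" "snd v < length gs"
        by (auto simp: iff Mon_def)
      ultimately show "(u, v) \<in>
          inv_image ((r - Id) <*lex*> measure (\<lambda>i. length gs - i)) (\<lambda>u. (?l u, snd u))"
        by (auto simp: iff)
    qed
  qed
  moreover have "(mon_mult c u, mon_mult c v) \<in> ?q" if "(u, v) \<in> ?q" for c and u v :: "'x mmon"
    using that ord_mult[of "?l u" "?l v" c] unfolding iff image_lm_mon_mult by auto
  ultimately show ?thesis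
    by (simp add: monomial_order_def order_on_defs)
qed

end


section \<open>Projected Schreyer syzygies\<close>

lemma lookup_proj: "Poly_Mapping.lookup (proj t f) i = (if i < t then Poly_Mapping.lookup f i else 0)"
proof -
  have "Poly_Mapping.lookup (proj t f) i = (\<Sum>k<t. if k = i then Poly_Mapping.lookup f i else 0)"
    unfolding proj_def lookup_sum by (rule sum.cong) (auto simp: lookup_single when_def)
  then show ?thesis
    by simp
qed

lemma supp_proj: "u \<in> supp (proj t f) \<longleftrightarrow> u \<in> supp f \<and> snd u < t"
  by (simp add: in_supp_iff mcoeff_def lookup_proj)

lemma proj_in_free_mod: "proj t f \<in> free_mod t"
  by (auto simp: free_mod_iff supp_proj Mon_def)

lemma proj_free_mod_id: "f \<in> free_mod t \<Longrightarrow> proj t f = f"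
  by (rule poly_mapping_eqI)
    (auto simp: free_mod_def lookup_proj simp flip: not_in_keys_iff_lookup_eq_zero)

lemma sum_lessThan_add: "(\<Sum>k<a + b. f k) = (\<Sum>k<a. f k) + (\<Sum>k<b. f (a + k))"
  for f :: "nat \<Rightarrow> 'a::comm_monoid_add"
  by (induction b) (simp_all add: add_ac)

lemma lin_comb_append:
  assumes "Rmod.subspace U" "set us \<subseteq> U"
  shows "lin_comb (hs @ us) f - lin_comb hs (proj (length hs) f) \<in> U"
proof -
  have "lin_comb (hs @ us) f - lin_comb hs (proj (length hs) f)
      = (\<Sum>k<length us. smul (Poly_Mapping.lookup f (length hs + k)) (us ! k))"
    by (simp add: lin_comb_def sum_lessThan_add nth_append lookup_proj)
  also have "\<dots> \<in> U"
    using assms by (intro Rmod.subspace_sum Rmod.subspace_scale) auto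
  finally show ?thesis .
qed

lemma subspace_rel_syz:
  assumes "Rmod.subspace U"
  shows "Rmod.subspace (rel_syz U hs)"
proof (rule Rmod.subspaceI)
  show "0 \<in> rel_syz U hs"
    using assms by (auto simp: rel_syz_def Rmod.subspace_0 subspace_free_mod)
  show "x + y \<in> rel_syz U hs" if "x \<in> rel_syz U hs" "y \<in> rel_syz U hs" for x y
    using that assms
    by (auto simp: rel_syz_def lin_comb_add intro: Rmod.subspace_add subspace_free_mod)
  show "smul c x \<in> rel_syz U hs" if "x \<in> rel_syz U hs" for c x
    using that assms
    by (auto simp: rel_syz_def lin_comb_smul intro: Rmod.subspace_scale subspace_free_mod)
qed

lemma exp_lcm_cofactors:
  fixes a b :: "'x \<Rightarrow>\<^sub>0 nat"
  shows "(exp_lcm a b - a) + a = (exp_lcm b a - b) + b"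
  by (rule poly_mapping_eqI) (simp add: lookup_add lookup_minus lookup_exp_lcm)

text \<open>
  If \<open>X^e X^a = X^e' X^b\<close> is a common multiple of \<open>X^a\<close> and
  \<open>X^b\<close>, the cofactor \<open>lcm / X^a\<close> divides \<open>X^e\<close>. This is what
  turns a coincidence of leading monomials into divisibility by a Schreyer syzygy.
\<close>

lemma exp_lcm_quot_least:
  fixes a b e e' :: "'x \<Rightarrow>\<^sub>0 nat"
  assumes "e + a = e' + b"
  shows "\<exists>d. e = d + (exp_lcm a b - a)"
proof (intro exI poly_mapping_eqI)
  fix x
  have "Poly_Mapping.lookup e x + Poly_Mapping.lookup a x
      = Poly_Mapping.lookup e' x + Poly_Mapping.lookup b x"
    by (metis assms lookup_add)
  then show "Poly_Mapping.lookup e x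
      = Poly_Mapping.lookup ((e - (exp_lcm a b - a)) + (exp_lcm a b - a)) x"
    by (simp add: lookup_add lookup_minus lookup_exp_lcm)
qed

lemma (in mon_order) supp_spoly:
  assumes f: "f \<in> free_mod m" "f \<noteq> 0" and g: "g \<in> free_mod m" "g \<noteq> 0"
    and pos: "snd (lm r f) = snd (lm r g)" and "w \<in> supp (spoly r f g)"
  shows "(w, mon_mult (exp_lcm (fst (lm r f)) (fst (lm r g)) - fst (lm r f)) (lm r f)) \<in> r - Id"
    (is "(w, mon_mult ?c (lm r f)) \<in> _")
proof -
  let ?d = "exp_lcm (fst (lm r g)) (fst (lm r f)) - fst (lm r g)"
  have eq: "mon_mult ?c (lm r f) = mon_mult ?d (lm r g)"
    using pos exp_lcm_cofactors by (simp add: mon_mult_def)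
  have nz: "lc r f \<noteq> 0" "lc r g \<noteq> 0"
    using f g by (simp_all add: lc_nonzero)
  show ?thesis
  proof (rule supp_diff_cancel)
    show "w \<in> supp (smul (cofactor r f g) f - smul (cofactor r g f) g)"
      using assms(6) by (simp add: spoly_def)
    show "(v, mon_mult ?c (lm r f)) \<in> r" if "v \<in> supp (smul (cofactor r f g) f)" for v
      using that f nz by (auto simp: cofactor_def supp_smul_term lm_max ord_mult)
    show "(v, mon_mult ?c (lm r f)) \<in> r" if "v \<in> supp (smul (cofactor r g f) g)" for v
      unfolding eq using that g nz by (auto simp: cofactor_def supp_smul_term lm_max ord_mult)
    have "mcoeff (smul (cofactor r f g) f) (mon_mult ?c (lm r f)) = 1"
      using nz unfolding cofactor_def mcoeff_smul_term by (simp add: lc_def)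
    moreover have "mcoeff (smul (cofactor r g f) g) (mon_mult ?d (lm r g)) = 1"
      using nz unfolding cofactor_def mcoeff_smul_term by (simp add: lc_def)
    ultimately show "mcoeff (smul (cofactor r f g) f) (mon_mult ?c (lm r f))
        = mcoeff (smul (cofactor r g f) g) (mon_mult ?c (lm r f))"
      by (simp add: eq)
  qed
qed

text \<open>
  The situation at every stage: \<open>us\<close> is a Groebner basis of \<open>U\<close>, and
  adding the elements of \<open>hs\<close> in front of it gives one of \<open>V\<close>. The
  elements of \<open>hs\<close> come first in the list, so every element of \<open>us\<close> has a
  larger index than every element of \<open>hs\<close>. The first stage is the relative one; later
  stages have \<open>U = 0\<close> and \<open>us = []\<close>.
\<close>

locale relative_basis = mon_order m r
  for m :: nat and r :: "'x mmon rel" +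
  fixes U V :: "('x, 'k::field) vec set" and hs us :: "('x, 'k) vec list"
  assumes subspace_U: "Rmod.subspace U" and subspace_V: "Rmod.subspace V"
    and U_subset_V: "U \<subseteq> V" and V_subset_free_mod: "V \<subseteq> free_mod m"
    and hs_subset: "set hs \<subseteq> V - {0}"
    and groebner_basis_U: "groebner_basis r U (set us)"
    and lm_V_covered: "f \<in> V \<Longrightarrow> f \<noteq> 0 \<Longrightarrow> \<exists>g \<in> set (hs @ us). mon_dvd (lm r g) (lm r f)"
begin

lemma us_subset: "set us \<subseteq> U - {0}"
  and lm_U_covered: "f \<in> U \<Longrightarrow> f \<noteq> 0 \<Longrightarrow> \<exists>g \<in> set us. mon_dvd (lm r g) (lm r f)"
proof -
  have "U \<subseteq> free_mod m"
    using U_subset_V V_subset_free_mod by blast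
  note iff = groebner_basis_iff[OF subspace_U this, THEN iffD1, OF groebner_basis_U]
  show "set us \<subseteq> U - {0}"
    using iff by blast
  show "\<exists>g \<in> set us. mon_dvd (lm r g) (lm r f)" if "f \<in> U" "f \<noteq> 0"
    using iff that by blast
qed

lemma basis_subset: "set (hs @ us) \<subseteq> V - {0}"
  using hs_subset us_subset U_subset_V by auto

lemma hs_subset_free_mod: "set hs \<subseteq> free_mod m - {0}"
  using hs_subset V_subset_free_mod by blast

lemma hs_nth: "i < length hs \<Longrightarrow> hs ! i \<in> free_mod m \<and> hs ! i \<noteq> 0"
  using subsetD[OF hs_subset_free_mod nth_mem] by simp

lemma basis_nth:
  assumes "i < length (hs @ us)"
  shows "(hs @ us) ! i \<in> V" "(hs @ us) ! i \<in> free_mod m" "(hs @ us) ! i \<noteq> 0"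
  using nth_mem[OF assms] basis_subset V_subset_free_mod by auto

sublocale induced: mon_order "length hs" "induced_order r hs"
  using monomial_order_induced[OF hs_subset_free_mod] by unfold_locales

lemma relative_division_exists:
  assumes "f \<in> V"
  shows "\<exists>a. division r (hs @ us) (rel_cancels r hs us) f a"
proof (rule division_exists[OF subspace_V V_subset_free_mod basis_subset _ _ assms])
  show "cancels r (hs @ us) f k" if "rel_cancels r hs us f k" for f k
    using that by (simp add: rel_cancels_def)
  show "\<exists>k. rel_cancels r hs us f k" if "f \<in> V" "f \<noteq> 0" for f
  proof -
    obtain g where "g \<in> set (hs @ us)" "mon_dvd (lm r g) (lm r f)"
      using lm_V_covered[OF \<open>f \<in> V\<close> \<open>f \<noteq> 0\<close>] by blast
    then obtain k where "cancels r (hs @ us) f k"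
      unfolding cancels_def in_set_conv_nth by blast
    then show ?thesis
      by (metis rel_cancels_def leD)
  qed
qed

text \<open>
  The leading monomial of \<open>S_ij\<close> is its \<open>e_i\<close>-term: the
  \<open>e_j\<close>-term has the same image \<open>m_ij\<close> but a larger index, and the
  quotients only contribute images below \<open>m_ij\<close>, because \<open>m_ij\<close> cancels in
  the S-polynomial. As \<open>i < length hs\<close>, the projection keeps this term; in particular
  it is nonzero.
\<close>

lemma projected_syzygy_lm:
  fixes a :: "('x, 'k) vec"
  assumes pair: "spair r (hs @ us) i j" and i: "i < length hs"
    and a: "division r (hs @ us) (rel_cancels r hs us) (spoly r ((hs @ us) ! i) ((hs @ us) ! j)) a"
  defines "S \<equiv> proj (length hs) (schreyer_syz r (hs @ us) i j a)"
  shows "S \<in> rel_syz U hs" and "S \<noteq> 0"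
    and "lm (induced_order r hs) S =
      (exp_lcm (fst (lm r ((hs @ us) ! i))) (fst (lm r ((hs @ us) ! j))) - fst (lm r ((hs @ us) ! i)), i)"
proof -
  let ?gs = "hs @ us"
  let ?f = "?gs ! i" and ?g = "?gs ! j"
  let ?c = "exp_lcm (fst (lm r ?f)) (fst (lm r ?g)) - fst (lm r ?f)"
  let ?d = "exp_lcm (fst (lm r ?g)) (fst (lm r ?f)) - fst (lm r ?g)"
  let ?T = "schreyer_syz r ?gs i j a"
  have ij: "i < j" "i < length ?gs" "j < length ?gs" and pos: "snd (lm r ?f) = snd (lm r ?g)"
    using pair by (auto simp: spair_def)
  note f = basis_nth[OF ij(2)] and g = basis_nth[OF ij(3)]
  have gs: "set ?gs \<subseteq> free_mod m - {0}"
    using basis_subset V_subset_free_mod by blast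
  have "spoly r ?f ?g \<in> free_mod m"
    unfolding spoly_def using f g
    by (intro Rmod.subspace_diff Rmod.subspace_scale subspace_free_mod)
  then have std: "lin_comb ?gs a = spoly r ?f ?g"
    "\<forall>(c, k) \<in> supp a. \<exists>u \<in> supp (spoly r ?f ?g). (mon_mult c (lm r (?gs ! k)), u) \<in> r"
    using division_standard_representation[OF a _ gs] by (auto simp: rel_cancels_def)
  have a_less: "(mon_mult c (lm r (?gs ! k)), mon_mult ?c (lm r ?f)) \<in> r - Id"
    if ck: "(c, k) \<in> supp a" for c k
  proof -
    obtain u where u: "u \<in> supp (spoly r ?f ?g)" "(mon_mult c (lm r (?gs ! k)), u) \<in> r"
      using std(2) ck by blast
    then have "(u, mon_mult ?c (lm r ?f)) \<in> r - Id"
      using supp_spoly[OF f(2,3) g(2,3) pos] by blast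
    with u(2) show ?thesis
      by (rule ord_le_less_trans)
  qed
  have "lin_comb ?gs ?T = 0"
    unfolding schreyer_syz_def lin_comb_diff lin_comb_single[OF ij(2)] lin_comb_single[OF ij(3)] std
    by (simp add: spoly_def)
  moreover have "lin_comb ?gs ?T - lin_comb hs S \<in> U"
    unfolding S_def using subspace_U us_subset by (intro lin_comb_append) auto
  ultimately have "lin_comb hs S \<in> U"
    using Rmod.subspace_neg[OF subspace_U] by fastforce
  then show "S \<in> rel_syz U hs"
    by (simp add: rel_syz_def S_def proj_in_free_mod)
  have "mcoeff a (?c, i) = 0"
    using a_less[of ?c i] by (auto simp: in_supp_iff)
  then have "mcoeff ?T (?c, i) = 1 / lc r ?f"
    using ij by (simp add: schreyer_syz_def cofactor_def)
  then have c_in: "(?c, i) \<in> supp S"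
    using lc_nonzero[OF f(2,3)] i unfolding S_def supp_proj by (simp add: in_supp_iff)
  then show "S \<noteq> 0"
    by (auto simp: supp_def)
  show "lm (induced_order r hs) S = (?c, i)"
  proof (rule induced.lm_eqI[OF c_in])
    fix v assume "v \<in> supp S"
    then have v: "v \<in> supp ?T" "snd v < length hs"
      by (simp_all add: S_def supp_proj)
    have img: "image_lm r hs w = mon_mult (fst w) (lm r (?gs ! snd w))" if "snd w < length hs" for w
      using that by (simp add: image_lm_def nth_append)
    have "v = (?c, i) \<or> v = (?d, j) \<or> v \<in> supp a"
      using v(1) unfolding in_supp_iff schreyer_syz_def cofactor_def by (auto split: if_splits)
    then have "v = (?c, i) \<or> (image_lm r hs v, image_lm r hs (?c, i)) \<in> r - Id \<or>
      image_lm r hs v = image_lm r hs (?c, i) \<and> i < snd v"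
    proof (elim disjE)
      assume vd: "v = (?d, j)"
      have "mon_mult ?d (lm r ?g) = mon_mult ?c (lm r ?f)"
        using pos exp_lcm_cofactors by (simp add: mon_mult_def)
      then have "image_lm r hs v = image_lm r hs (?c, i)"
        using img[of v] img[of "(?c, i)"] v(2) i vd by simp
      then show ?thesis
        using vd ij by simp
    next
      assume "v \<in> supp a"
      then have "(image_lm r hs v, image_lm r hs (?c, i)) \<in> r - Id"
        using a_less[of "fst v" "snd v"] img[of v] img[of "(?c, i)"] v(2) i by simp
      then show ?thesis
        by simp
    qed simp
    then show "(v, (?c, i)) \<in> induced_order r hs"
      using v(2) i by (simp add: induced_order_iff[OF hs_subset_free_mod] Mon_def)
  qed
qed

text \<open>
  Let \<open>X^e e_i\<close> be the leading monomial of the relation \<open>f\<close> and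
  \<open>M\<close> its image, which bounds every monomial occurring in any \<open>f_l h_l\<close>.
  If \<open>M\<close> cancels in \<open>\<Sum> f_l h_l\<close>, then it is also the image of a term
  of \<open>f\<close> with another index \<open>l\<close>, and \<open>l > i\<close> by the
  tie-breaking rule. If it survives, it is the leading monomial of an element of \<open>U\<close>,
  hence divisible by that of an element of \<open>us\<close>, whose index also exceeds
  \<open>i\<close>. In both cases some \<open>S_ij\<close> has a leading monomial dividing
  \<open>X^e e_i\<close>.
\<close>

lemma syzygy_lm_covered:
  assumes f: "f \<in> rel_syz U hs" "f \<noteq> 0"
  obtains i j where "spair r (hs @ us) i j" "i < length hs"
    "mon_dvd (exp_lcm (fst (lm r ((hs @ us) ! i))) (fst (lm r ((hs @ us) ! j)))
        - fst (lm r ((hs @ us) ! i)), i) (lm (induced_order r hs) f)"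
proof -
  let ?q = "induced_order r hs" and ?gs = "hs @ us"
  obtain e i where ei: "lm ?q f = (e, i)"
    by fastforce
  have ff: "f \<in> free_mod (length hs)" and fU: "lin_comb hs f \<in> U"
    using f by (auto simp: rel_syz_def)
  have ei_in: "(e, i) \<in> supp f"
    using induced.lm_in_supp[OF ff f(2)] ei by simp
  then have i: "i < length hs"
    using ff by (auto simp: free_mod_iff Mon_def)
  define M where "M = image_lm r hs (e, i)"
  have M: "M = mon_mult e (lm r (hs ! i))"
    by (simp add: M_def image_lm_def)
  have hi: "hs ! i \<in> free_mod m" "hs ! i \<noteq> 0"
    using hs_nth[OF i] by simp_all
  have "M \<in> Mon m"
    using lm_in_Mon[OF hi] by (simp add: M)
  have le_M: "(mon_mult c u, M) \<in> r \<and> (mon_mult c u = M \<longrightarrow> u = lm r (hs ! l) \<and> ((c, l) = (e, i) \<or> i < l))"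
    if cl: "(c, l) \<in> supp f" and l: "l < length hs" and u: "u \<in> supp (hs ! l)" for c l u
  proof -
    have hl: "hs ! l \<in> free_mod m" "hs ! l \<noteq> 0"
      using hs_nth[OF l] by simp_all
    have 1: "(mon_mult c u, image_lm r hs (c, l)) \<in> r"
      using lm_max[OF hl(1) u] by (simp add: image_lm_def ord_mult)
    have "((c, l), (e, i)) \<in> ?q"
      using induced.lm_max[OF ff cl] ei by simp
    then have 2: "(c, l) = (e, i) \<or> (image_lm r hs (c, l), M) \<in> r - Id \<or>
        image_lm r hs (c, l) = M \<and> i < l"
      unfolding induced_order_iff[OF hs_subset_free_mod] M_def by simp
    have 3: "(image_lm r hs (c, l), M) \<in> r"
      using 2 ord_refl[OF \<open>M \<in> Mon m\<close>] by (auto simp: M_def)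
    show ?thesis
    proof (intro conjI impI)
      show "(mon_mult c u, M) \<in> r"
        using 1 3 ord_trans by blast
      assume "mon_mult c u = M"
      then have *: "image_lm r hs (c, l) = M"
        using 1 3 ord_antisym by blast
      then show "u = lm r (hs ! l)"
        using \<open>mon_mult c u = M\<close> by (metis image_lm_def fst_conv snd_conv mon_mult_inj)
      show "(c, l) = (e, i) \<or> i < l"
        using 2 * by auto
    qed
  qed
  have "\<exists>j c. i < j \<and> j < length ?gs \<and> M = mon_mult c (lm r (?gs ! j))"
  proof (cases "mcoeff (lin_comb hs f) M = 0")
    case False
    then have "M \<in> supp (lin_comb hs f)" and nz: "lin_comb hs f \<noteq> 0"
      by (auto simp: in_supp_iff)
    moreover have "(w, M) \<in> r" if "w \<in> supp (lin_comb hs f)" for w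
      using that le_M by (auto elim!: supp_lin_comb)
    ultimately have "lm r (lin_comb hs f) = M"
      by (intro lm_eqI)
    then obtain g where "g \<in> set us" "mon_dvd (lm r g) M"
      using lm_U_covered[OF fU nz] by auto
    then obtain k where "k < length us" "mon_dvd (lm r (us ! k)) M"
      by (auto simp: in_set_conv_nth)
    then show ?thesis
      using i by (intro exI[of _ "length hs + k"]) (auto simp: mon_dvd_def)
  next
    case True
    \<comment> \<open>Without the leading term of \<open>f\<close>, the remaining terms must produce \<open>M\<close> with the opposite coefficient.\<close>
    define k where "k = mcoeff f (e, i)"
    let ?t = "Poly_Mapping.single i (Poly_Mapping.single e k)"
    have "k \<noteq> 0"
      using ei_in by (simp add: k_def in_supp_iff)
    have "mcoeff (lin_comb hs ?t) M = k * lc r (hs ! i)"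
      unfolding lin_comb_single[OF i] M mcoeff_smul_term lc_def ..
    also have "\<dots> \<noteq> 0"
      using \<open>k \<noteq> 0\<close> lc_nonzero[OF hi] by simp
    finally have "M \<in> supp (lin_comb hs (f - ?t))"
      using True by (simp add: in_supp_iff lin_comb_diff)
    then obtain c l u where l: "(c, l) \<in> supp (f - ?t)" "l < length hs" "u \<in> supp (hs ! l)"
      "M = mon_mult c u"
      by (rule supp_lin_comb)
    have "(c, l) \<noteq> (e, i)" "(c, l) \<in> supp f"
      using l(1) by (auto simp: in_supp_iff k_def split: if_splits)
    then have "i < l" "M = mon_mult c (lm r (hs ! l))"
      using le_M[of c l u] l by auto
    then show ?thesis
      using l(2) by (intro exI[of _ l] exI[of _ c]) (simp add: nth_append)
  qed
  then obtain j c where j: "i < j" "j < length ?gs" "M = mon_mult c (lm r (?gs ! j))"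
    by blast
  have M': "M = mon_mult e (lm r (?gs ! i))"
    using M i by (simp add: nth_append)
  have "spair r ?gs i j"
    using j M' unfolding spair_def by (metis snd_mon_mult)
  moreover have "e + fst (lm r (?gs ! i)) = c + fst (lm r (?gs ! j))"
    using j(3) M' by (simp add: mon_mult_def)
  then obtain d where "e = d + (exp_lcm (fst (lm r (?gs ! i))) (fst (lm r (?gs ! j)))
      - fst (lm r (?gs ! i)))"
    using exp_lcm_quot_least by blast
  then have "lm ?q f = mon_mult d
      (exp_lcm (fst (lm r (?gs ! i))) (fst (lm r (?gs ! j))) - fst (lm r (?gs ! i)), i)"
    by (simp add: ei mon_mult_def)
  ultimately show ?thesis
    using i by (intro that) (auto simp: mon_dvd_def)
qed

theorem groebner_basis_projected_syzygies:
  assumes D: "\<And>f. f \<in> V \<Longrightarrow> division r (hs @ us) (rel_cancels r hs us) f (D r hs us f)"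
  shows "groebner_basis (induced_order r hs) (rel_syz U hs) (projected_syzygies D r hs us)"
proof -
  let ?gs = "hs @ us"
  let ?S = "\<lambda>i j. proj (length hs) (schreyer_syz r ?gs i j (D r hs us (spoly r (?gs ! i) (?gs ! j))))"
  have sub: "rel_syz U hs \<subseteq> free_mod (length hs)"
    by (auto simp: rel_syz_def)
  have div: "division r ?gs (rel_cancels r hs us) (spoly r (?gs ! i) (?gs ! j))
      (D r hs us (spoly r (?gs ! i) (?gs ! j)))" if "spair r ?gs i j" for i j
  proof (rule D)
    have "i < length ?gs" "j < length ?gs"
      using that by (auto simp: spair_def)
    then show "spoly r (?gs ! i) (?gs ! j) \<in> V"
      unfolding spoly_def using basis_nth subspace_V
      by (intro Rmod.subspace_diff Rmod.subspace_scale)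
  qed
  note S = projected_syzygy_lm[OF _ _ div]
  have fin: "finite (projected_syzygies D r hs us)"
  proof (rule finite_subset)
    show "projected_syzygies D r hs us
        \<subseteq> (\<lambda>(i, j). ?S i j) ` ({..<length ?gs} \<times> {..<length ?gs})"
      by (force simp: projected_syzygies_def spair_def)
  qed simp
  show ?thesis
    unfolding induced.groebner_basis_iff[OF subspace_rel_syz[OF subspace_U] sub]
  proof (intro conjI ballI fin)
    show "0 \<notin> projected_syzygies D r hs us"
      using S(2) by (force simp: projected_syzygies_def)
    show "projected_syzygies D r hs us \<subseteq> rel_syz U hs"
      using S(1) by (auto simp: projected_syzygies_def)
    fix f assume "f \<in> rel_syz U hs - {0}"
    then have "f \<in> rel_syz U hs" "f \<noteq> 0"
      by auto
    then obtain i j where ij: "spair r ?gs i j" "i < length hs"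
      "mon_dvd (exp_lcm (fst (lm r (?gs ! i))) (fst (lm r (?gs ! j)))
        - fst (lm r (?gs ! i)), i) (lm (induced_order r hs) f)"
      by (rule syzygy_lm_covered)
    then have "mon_dvd (lm (induced_order r hs) (?S i j)) (lm (induced_order r hs) f)"
      by (simp add: S(3))
    moreover have "?S i j \<in> projected_syzygies D r hs us"
      using ij by (auto simp: projected_syzygies_def)
    ultimately show "\<exists>g\<in>projected_syzygies D r hs us.
        mon_dvd (lm (induced_order r hs) g) (lm (induced_order r hs) f)"
      by blast
  qed
qed

end


section \<open>Schreyer's theorem and its iteration\<close>

lemma rel_cancels_Nil: "rel_cancels r gs [] = cancels r gs"
  by (auto simp: fun_eq_iff rel_cancels_def cancels_def)

lemma rel_syz_0: "rel_syz {0} gs = syz gs"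
  by (simp add: rel_syz_def syz_def)

lemma groebner_basis_0: "groebner_basis r {0} {}"
  by (simp add: groebner_basis_def lm_gen_def lm_space_def)

text \<open>
  Schreyer's theorem as the relative case with \<open>U = 0\<close> and \<open>us = []\<close>: the
  relative division algorithm is then ordinary division, and the projection fixes the syzygies since
  they already lie in the free module on \<open>gs\<close>.
\<close>

lemma (in mon_order) groebner_basis_schreyer_syzygies:
  fixes gs :: "('x, 'k::field) vec list"
  assumes gb: "groebner_basis r W (set gs)" and W: "W \<subseteq> free_mod m" and D: "division_rule D"
  shows "groebner_basis (induced_order r gs) (syz gs) (schreyer_syzygies D r gs)"
proof -
  have sub: "Rmod.subspace W"
    using gb by (auto simp: groebner_basis_def)
  note basis = groebner_basis_iff[OF sub W, THEN iffD1, OF gb]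
  interpret relative_basis m r "{0}" W gs "[]"
  proof
    show "Rmod.subspace {0 :: ('x, 'k) vec}"
      by (rule Rmod.subspace_single_0)
    show "{0} \<subseteq> W"
      using Rmod.subspace_0[OF sub] by simp
    show "groebner_basis r {0 :: ('x, 'k) vec} (set [])"
      by (simp add: groebner_basis_0)
    show "set gs \<subseteq> W - {0}"
      using basis by blast
    show "\<exists>g\<in>set (gs @ []). mon_dvd (lm r g) (lm r f)" if "f \<in> W" "f \<noteq> 0" for f
      using basis that by simp
  qed (fact sub W)+
  have div: "division r gs (cancels r gs) f (D r gs f)" if "f \<in> W" for f
    using relative_division_exists[OF that] D by (auto simp: rel_cancels_Nil division_rule_def)
  have proj: "proj (length gs) (schreyer_syz r gs i j (D r gs (spoly r (gs ! i) (gs ! j))))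
      = schreyer_syz r gs i j (D r gs (spoly r (gs ! i) (gs ! j)))" if "spair r gs i j" for i j
  proof (rule proj_free_mod_id)
    have ij: "i < length gs" "j < length gs"
      using that by (auto simp: spair_def)
    have in_W: "spoly r (gs ! i) (gs ! j) \<in> W"
      unfolding spoly_def using ij basis_nth(1)[of i] basis_nth(1)[of j] sub
      by (intro Rmod.subspace_diff Rmod.subspace_scale) auto
    have "D r gs (spoly r (gs ! i) (gs ! j)) \<in> free_mod (length gs)"
      using division_standard_representation[OF div[OF in_W]] in_W W hs_subset_free_mod by blast
    moreover have "Poly_Mapping.single i p \<in> free_mod (length gs)"
      "Poly_Mapping.single j p \<in> free_mod (length gs)" for p :: "('x, 'k) mpoly"
      using ij by (auto simp: free_mod_def)
    ultimately show "schreyer_syz r gs i j (D r gs (spoly r (gs ! i) (gs ! j)))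
        \<in> free_mod (length gs)"
      unfolding schreyer_syz_def by (intro Rmod.subspace_diff subspace_free_mod)
  qed
  have "schreyer_syzygies D r gs = projected_syzygies (\<lambda>r hs us. D r hs) r gs []"
  proof -
    have "spair r gs i j \<Longrightarrow> i < length gs" for i j
      by (simp add: spair_def)
    then show ?thesis
      unfolding schreyer_syzygies_def projected_syzygies_def append_Nil2
      by (intro Collect_cong ex_cong1) (auto simp: proj)
  qed
  then show ?thesis
    using groebner_basis_projected_syzygies[of "\<lambda>r hs us. D r hs"] div
    by (simp add: rel_cancels_Nil rel_syz_0)
qed

text \<open>
  A leading monomial of \<open>V\<close> occurs in a sum of an element generated by the leading
  monomials of \<open>hs\<close> and one generated by those of \<open>us\<close>, so it occurs in
  one of the two summands.
\<close>

lemma relative_basis_of_rel_groebner_basis: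
  assumes "Rmod.subspace U" and "Rmod.subspace V" and "U \<subseteq> V" and V: "V \<subseteq> free_mod d"
    and "monomial_order d r"
    and H: "rel_groebner_basis d r U V (set hs)"
    and us: "groebner_basis r U (set us)"
  shows "relative_basis d r U V hs us"
proof -
  interpret mon_order d r
    using assms by unfold_locales
  have le: "set hs \<subseteq> V - U" and eq: "{a + b | a b. a \<in> lm_gen r (set hs) \<and> b \<in> lm_space r U} = lm_space r V"
    using H by (auto simp: rel_groebner_basis_def)
  show ?thesis
  proof
    show "set hs \<subseteq> V - {0}"
      using le Rmod.subspace_0[OF \<open>Rmod.subspace U\<close>] by blast
    show "\<exists>g\<in>set (hs @ us). mon_dvd (lm r g) (lm r f)" if "f \<in> V" "f \<noteq> 0" for f
    proof -
      have "mon_vec (lm r f) \<in> lm_space r V"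
        using \<open>f \<in> V\<close> \<open>f \<noteq> 0\<close> by (simp add: lm_space_eq)
      then obtain a b where ab: "mon_vec (lm r f) = a + b" "a \<in> lm_gen r (set hs)" "b \<in> lm_gen r (set us)"
        using eq us unfolding groebner_basis_def by blast
      then have "lm r f \<in> supp a \<union> supp b"
        using supp_add[of a b] by (metis supp_mon_vec insert_subset)
      then show ?thesis
        using ab(2,3) by (auto simp: lm_gen_eq)
    qed
  qed (use assms in auto)
qed

theorem theoremB:
  fixes U V H :: "('x::finite, 'k::field) vec set"
    and us :: "('x, 'k) vec list"
    and d :: nat
    and r :: "'x mmon rel"
    and L :: "nat \<Rightarrow> ('x, 'k) vec set \<Rightarrow> ('x, 'k) vec list"
    and D\<^sub>0 :: "'x mmon rel \<Rightarrow> ('x, 'k) vec list \<Rightarrow> ('x, 'k) vec list \<Rightarrow> ('x, 'k) vec \<Rightarrow> ('x, 'k) vec"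
    and D :: "'x mmon rel \<Rightarrow> ('x, 'k) vec list \<Rightarrow> ('x, 'k) vec \<Rightarrow> ('x, 'k) vec"
  defines "Hs \<equiv> \<lambda>i. snd (stage L D\<^sub>0 D r us H i)"
    and "ord \<equiv> \<lambda>i. fst (stage L D\<^sub>0 D r us H i)"
  assumes "Rmod.subspace U" and "Rmod.subspace V" and "U \<subseteq> V" and "V \<subseteq> free_mod d"
    and "monomial_order d r"
    and "reduced_rel_groebner_basis d r U V H"
    and "groebner_basis r U (set us)" and "distinct us"
    and "listing_rule L" and "rel_division_rule D\<^sub>0" and "division_rule D"
  shows "ord 1 = induced_order r (L 0 H) \<and> Hs 1 = projected_syzygies D\<^sub>0 r (L 0 H) us \<and>
         monomial_order (card H) (ord 1) \<and>
         groebner_basis (ord 1) (rel_syz U (L 0 H)) (Hs 1) \<and>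
         (\<forall>i\<ge>1. ord (Suc i) = induced_order (ord i) (L i (Hs i)) \<and>
            Hs (Suc i) = schreyer_syzygies D (ord i) (L i (Hs i)) \<and>
            monomial_order (card (Hs i)) (ord (Suc i)) \<and>
            groebner_basis (ord (Suc i)) (syz (L i (Hs i))) (Hs (Suc i)))"
proof -
  let ?hs = "L 0 H"
  have H: "rel_groebner_basis d r U V H"
    using assms(8) by (simp add: reduced_rel_groebner_basis_def)
  then have "finite H"
    by (simp add: rel_groebner_basis_def)
  then have hs: "set ?hs = H" "length ?hs = card H"
    using \<open>listing_rule L\<close> by (auto simp: listing_rule_def) (metis distinct_card)
  interpret relative_basis d r U V ?hs us
    using relative_basis_of_rel_groebner_basis[of U V d r ?hs us] assms H hs by simp
  have ord1: "ord 1 = induced_order r ?hs" and Hs1: "Hs 1 = projected_syzygies D\<^sub>0 r ?hs us"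
    by (simp_all add: ord_def Hs_def Let_def)
  have stage_Suc: "ord (Suc i) = induced_order (ord i) (L i (Hs i)) \<and>
      Hs (Suc i) = schreyer_syzygies D (ord i) (L i (Hs i))" if "i \<ge> 1" for i
    using that by (simp add: ord_def Hs_def Let_def case_prod_beta)
  have "division r (?hs @ us) (rel_cancels r ?hs us) f (D\<^sub>0 r ?hs us f)" if "f \<in> V" for f
    using relative_division_exists[OF that] \<open>rel_division_rule D\<^sub>0\<close>
    by (simp add: rel_division_rule_def)
  then have gb1: "groebner_basis (ord 1) (rel_syz U ?hs) (Hs 1)"
    unfolding ord1 Hs1 by (rule groebner_basis_projected_syzygies)
  have mo1: "monomial_order (card H) (ord 1)"
    using induced.monomial_order unfolding ord1 hs(2) .
  have next_stage: "length (L i (Hs i)) = card (Hs i) \<and>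
      monomial_order (card (Hs i)) (ord (Suc i)) \<and>
      groebner_basis (ord (Suc i)) (syz (L i (Hs i))) (Hs (Suc i))"
    if i: "i \<ge> 1" and mo: "monomial_order n (ord i)" and W: "W \<subseteq> free_mod n"
      and gb: "groebner_basis (ord i) W (Hs i)" for i n W
  proof -
    interpret q: mon_order n "ord i"
      using mo by unfold_locales
    have "finite (Hs i)"
      using gb by (simp add: groebner_basis_def)
    then have L: "set (L i (Hs i)) = Hs i" "length (L i (Hs i)) = card (Hs i)"
      using \<open>listing_rule L\<close> by (auto simp: listing_rule_def) (metis distinct_card)
    have "Hs i \<subseteq> free_mod n - {0}"
      using gb W Rmod.span_superset by (auto simp: groebner_basis_def)
    then show ?thesis
      using q.monomial_order_induced[of "L i (Hs i)"] L stage_Suc[OF i]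
        q.groebner_basis_schreyer_syzygies[of W "L i (Hs i)" D] gb W \<open>division_rule D\<close>
      by simp
  qed
  \<comment> \<open>All that a stage passes on: it is a Groebner basis of some submodule for a monomial order.\<close>
  have basis: "\<exists>n W. monomial_order n (ord i) \<and> W \<subseteq> free_mod n \<and> groebner_basis (ord i) W (Hs i)"
    if "i \<ge> 1" for i
    using that
  proof (induction i rule: dec_induct)
    case base
    have "rel_syz U ?hs \<subseteq> free_mod (card H)"
      by (auto simp: rel_syz_def hs)
    then show ?case
      using mo1 gb1 by blast
  next
    case (step i)
    then obtain n W where "monomial_order n (ord i)" "W \<subseteq> free_mod n" "groebner_basis (ord i) W (Hs i)"
      by blast
    note * = next_stage[OF step.hyps(1) this]
    have "syz (L i (Hs i)) \<subseteq> free_mod (card (Hs i))"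
      using * by (auto simp: syz_def)
    then show ?case
      using * by blast
  qed
  have "monomial_order (card (Hs i)) (ord (Suc i)) \<and>
      groebner_basis (ord (Suc i)) (syz (L i (Hs i))) (Hs (Suc i))" if "i \<ge> 1" for i
    using basis[OF that] next_stage[OF that] by blast
  then show ?thesis
    using ord1 Hs1 mo1 gb1 stage_Suc by blast
qed

end
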